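(* Let $d\ge2$, let $D\subset\mathbb{R}^d$ be a bounded domain, let $\mathbf{K}:D\to\mathbb{R}^{d\times d}$ be bounded, measurable, symmetric and strictly elliptic, and let $\Gamma_1\subset\partial D$ be a nonempty Borel set. Let $\sigma$ be the restriction of the $(d-1)$-dimensional Hausdorff measure to $\partial D$, and assume that for every $\mathbf{x}\in D$ the elliptic measure $\mu_{\mathbf{x}}$ associated with $\operatorname{div}(\mathbf{K}\nabla)$ in $D$ with pole $\mathbf{x}$ is absolutely continuous with respect to $\sigma$ with density $\rho_{\mathbf{x}}:=\frac{d\mu_{\mathbf{x}}}{d\sigma}\in L^2(\partial D,\sigma)$. Let $M_D\ge1$, $\mathbf{x}^D_1,\dots,\mathbf{x}^D_{M_D}\in D$, and let $\boldsymbol{\nu}=(\nu_i)_{i=1}^{M_D}$ satisfy $\nu_i\in(0,1)$, $\sum_{i=1}^{M_D}\nu_i^2=1$. Let $$T_{\boldsymbol{\nu}}:L^2(\Gamma_1,\sigma)\to\mathbb{R}^{M_D},\quad T_{\boldsymbol{\nu}}u=\Big(\nu_i\int_{\Gamma_1}u\,\rho_{\mathbf{x}^D_i}\,d\sigma\Big)_{i=1}^{M_D},\qquad \boldsymbol{\Lambda}^{\boldsymbol{\nu}}=\Big(\nu_i\nu_j\int_{\Gamma_1}\rho_{\mathbf{x}^D_i}\rho_{\mathbf{x}^D_j}\,d\sigma\Big)_{i,j=1}^{M_D}.$$ Let $\mathbf{b}\in\mathbb{R}^{M_D}$, $\mathbf{b}^{\boldsymbol{\nu}}:=\operatorname{diag}(\boldsymbol{\nu})\,\mathbf{b}$,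 let $k:=\dim\big(\operatorname{Ker}(T_{\boldsymbol{\nu}}^*T_{\boldsymbol{\nu}})\big)^\perp$ and let $r\in\{1,\dots,k\}$. Let $u^{(r)}\in L^2(\Gamma_1,\sigma)$ be the $r$-TSVD solution of the operator equation $T_{\boldsymbol{\nu}}u=\mathbf{b}^{\boldsymbol{\nu}}$ and let $\mathbf{u}^{(r)}:=(\boldsymbol{\Lambda}^{\boldsymbol{\nu}})^\dagger_r\mathbf{b}^{\boldsymbol{\nu}}\in\mathbb{R}^{M_D}$ be the $r$-TSVD solution of the linear system $\boldsymbol{\Lambda}^{\boldsymbol{\nu}}\mathbf{u}=\mathbf{b}^{\boldsymbol{\nu}}$ (both defined in the context). Then $$u^{(r)}=\sum_{j=1}^{M_D}\nu_j\,[\mathbf{u}^{(r)}]_j\,\rho_{\mathbf{x}^D_j}\qquad\text{in }L^2(\Gamma_1,\sigma).$$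
   Context: A domain is a nonempty connected open set. Strict ellipticity of $\mathbf{K}$ means that there is $\lambda_0>0$ with $\xi\cdot\mathbf{K}(\mathbf{x})\xi\ge\lambda_0|\xi|^2$ for all $\mathbf{x}\in D$, $\xi\in\mathbb{R}^d$. $\mathbb{R}^{M_D}$ carries the Euclidean inner product and $[\mathbf{v}]_j$ is the $j$-th component of $\mathbf{v}$. The adjoint of $T_{\boldsymbol{\nu}}$ is $T_{\boldsymbol{\nu}}^*\mathbf{v}=\sum_{i}\nu_iv_i\,\rho_{\mathbf{x}^D_i}|_{\Gamma_1}$. Elliptic measure: a local solution of $\operatorname{div}(\mathbf{K}\nabla u)=0$ in $D$ is a function $u\in H^1_{loc}(D)$ (taken continuous) with $\int_D\nabla u\cdot(\mathbf{K}\nabla\varphi)\,d\mathbf{x}=0$ for all $\varphi\in C_c^1(D)$. For every $f\in C(\partial D)$ let $u_f$ be the unique solution of the Dirichlet problem with data $f$, i.e. the local solution with $\lim_{\mathbf{x}\to\mathbf{y},\,\mathbf{x}\in D}u_f(\mathbf{x})=f(\mathbf{y})$ at every regular boundary point $\mathbf{y}$ (regular for the Dirichlet problem); $\mu_{\mathbf{x}}$ is the unique probability measure on $\partial D$ with $u_f(\mathbf{x})=\int_{\partial D} f\,d\mu_{\mathbf{x}}$ for all $f\in C(\partial D)$. $r$-TSVD solution of the operator equation. Let $\lambda_1\ge\lambda_2\ge\dots\ge\lambda_k>0$ be the nonzero eigenvalues of $T_{\boldsymbol{\nu}}^*T_{\boldsymbol{\nu}}$ in decreasing order, including their multiplicities.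 Let $P_r$ be the (orthogonal) projection operator of $L^2(\Gamma_1,\sigma)$ onto $$\operatorname{span}\{v\in L^2(\Gamma_1,\sigma)\;:\;T_{\boldsymbol{\nu}}^*T_{\boldsymbol{\nu}}v=\lambda_iv,\ i=1,\dots,r\},$$ the linear space generated by the eigenfunctions of $T_{\boldsymbol{\nu}}^*T_{\boldsymbol{\nu}}$ corresponding to the largest $r$ nonzero eigenvalues $\lambda_1\ge\dots\ge\lambda_r$. Then $u^{(r)}:=P_ru$, where $u\in L^2(\Gamma_1,\sigma)$ is any solution of $T_{\boldsymbol{\nu}}^*T_{\boldsymbol{\nu}}u=T_{\boldsymbol{\nu}}^*\mathbf{b}^{\boldsymbol{\nu}}$. $r$-TSVD solution of a linear system. For a matrix $\mathbf{B}\in\mathbb{R}^{n\times m}$ of positive rank with singular value decomposition $\mathbf{B}=\mathbf{U}\boldsymbol{\Sigma}\mathbf{V}^{\mathsf T}$, where $\mathbf{U}\in\mathbb{R}^{n\times n}$, $\mathbf{V}\in\mathbb{R}^{m\times m}$ are orthogonal and $\boldsymbol{\Sigma}=\operatorname{diag}(\sigma_1(\mathbf{B}),\dots,\sigma_{\operatorname{rank}(\mathbf{B})}(\mathbf{B}))\in\mathbb{R}^{n\times m}$ with positive singular values $\sigma_1(\mathbf{B})\ge\sigma_2(\mathbf{B})\ge\dots>0$, and for $1\le r\le\operatorname{rank}(\mathbf{B})$, set $\mathbf{B}^\dagger_r:=\mathbf{V}\boldsymbol{\Sigma}_r^{-1}\mathbf{U}^{\mathsf T}$ with $\boldsymbol{\Sigma}_r^{-1}:=\operatorname{diag}(\sigma_1(\mathbf{B})^{-1},\dots,\sigma_r(\mathbf{B})^{-1})\in\mathbb{R}^{m\times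 n}$ (remaining entries zero). The $r$-TSVD solution of $\mathbf{B}\mathbf{v}=\mathbf{q}$ is $\mathbf{v}^{(r)}:=\mathbf{B}^\dagger_r\mathbf{q}$. It is applied with $\mathbf{B}=\boldsymbol{\Lambda}^{\boldsymbol{\nu}}$, a symmetric non-negative definite matrix of rank $k$, and $\mathbf{q}=\mathbf{b}^{\boldsymbol{\nu}}$.
   Formalization: If λ_r=λ_{r+1} the literal identity can fail; it is proved for r=k or λ_{r+1}<λ_r, and for ties with P_r projecting onto r orthonormal eigenfunctions matched to the SVD of Λ^ν (each choice of one has a matching other). Dirichlet solutions are required bounded, for uniqueness. *)

theory Defs
  imports "HOL-Analysis.Analysis" "HOL-Probability.Probability_Measure" "Jordan_Normal_Form.DL_Rank"
begin

no_notation vec_nth (infixl \<open>$\<close> 90)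
no_notation scalar_prod (infix \<open>\<bullet>\<close> 70)

section \<open>Hausdorff measure\<close>

text \<open>The normalisation makes the \<open>n\<close>-dimensional measure on an \<open>n\<close>-dimensional Euclidean space
  agree with Lebesgue measure. Only \<open>s \<ge> 1\<close> is used; the case distinction on the empty set matters
  only for \<open>s = 0\<close>, where \<open>0 ^ 0 = 1\<close>.\<close>

definition hausdorff_pre :: "nat \<Rightarrow> real \<Rightarrow> 'a::metric_space set \<Rightarrow> ennreal" where
  "hausdorff_pre s \<delta> A =
     (INF U \<in> {U :: nat \<Rightarrow> 'a set. A \<subseteq> (\<Union>i. U i) \<and> (\<forall>i. bounded (U i) \<and> diameter (U i) \<le> \<delta>)}.
        \<Sum>i. if U i = {} then 0
             else ennreal (unit_ball_vol (real s) * (diameter (U i) / 2) ^ s))"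

definition hausdorff_outer :: "nat \<Rightarrow> 'a::metric_space set \<Rightarrow> ennreal" where
  "hausdorff_outer s A = (SUP \<delta> \<in> {0<..}. hausdorff_pre s \<delta> A)"

text \<open>The outer measure is a metric outer measure, so by Caratheodory's criterion it is countably
  additive on the Borel sets, which is what \<^const>\<open>measure_of\<close> requires in order not to return the
  zero measure.\<close>

definition hausdorff_measure :: "nat \<Rightarrow> 'a::metric_space measure" where
  "hausdorff_measure s = measure_of UNIV (sets borel) (hausdorff_outer s)"

definition boundary_measure :: "(real^'n) set \<Rightarrow> (real^'n) measure" where
  "boundary_measure D = restrict_space (hausdorff_measure (CARD('n) - 1)) (frontier D)"

section \<open>Square integrable functions\<close>

text \<open>Elements of \<open>L\<^sup>2\<close> are handled through representatives: equality in \<open>L\<^sup>2\<close> is equality almost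
  everywhere, and all notions of linear algebra below are taken modulo null functions.\<close>

definition L2 :: "'a measure \<Rightarrow> ('a \<Rightarrow> 'b::euclidean_space) set" where
  "L2 M = {f \<in> borel_measurable M. integrable M (\<lambda>x. (norm (f x))\<^sup>2)}"

definition L2_span :: "'a measure \<Rightarrow> ('a \<Rightarrow> real) set \<Rightarrow> ('a \<Rightarrow> real) set" where
  "L2_span M S = {f \<in> L2 M. \<exists>(n::nat) g c. (\<forall>i<n. g i \<in> S) \<and>
                              (AE x in M. f x = (\<Sum>i<n. c i * g i x))}"

definition L2_has_dim :: "'a measure \<Rightarrow> ('a \<Rightarrow> real) set \<Rightarrow> nat \<Rightarrow> bool" where
  "L2_has_dim M S n \<longleftrightarrow>
     (\<exists>e. (\<forall>i<n. e i \<in> S) \<and>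
          (\<forall>c. (AE x in M. (\<Sum>i<n. c i * e i x) = 0) \<longrightarrow> (\<forall>i<n. c i = 0)) \<and>
          (\<forall>f\<in>S. \<exists>c. AE x in M. f x = (\<Sum>i<n. c i * e i x)))"

text \<open>Unspecified for infinite-dimensional subspaces.\<close>

definition L2_dim :: "'a measure \<Rightarrow> ('a \<Rightarrow> real) set \<Rightarrow> nat" where
  "L2_dim M S = (THE n. L2_has_dim M S n)"

definition L2_orth :: "'a measure \<Rightarrow> ('a \<Rightarrow> real) set \<Rightarrow> ('a \<Rightarrow> real) set" where
  "L2_orth M S = {f \<in> L2 M. \<forall>g\<in>S. (LINT x|M. f x * g x) = 0}"

text \<open>\<open>g\<close> represents the orthogonal projection of \<open>f\<close> onto the subspace \<open>W\<close>.\<close>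

definition L2_proj :: "'a measure \<Rightarrow> ('a \<Rightarrow> real) set \<Rightarrow> ('a \<Rightarrow> real) \<Rightarrow> ('a \<Rightarrow> real) \<Rightarrow> bool" where
  "L2_proj M W f g \<longleftrightarrow> g \<in> W \<and> (\<lambda>x. f x - g x) \<in> L2_orth M W"

definition L2_kernel :: "'a measure \<Rightarrow> (('a \<Rightarrow> real) \<Rightarrow> ('a \<Rightarrow> real)) \<Rightarrow> ('a \<Rightarrow> real) set" where
  "L2_kernel M A = {u \<in> L2 M. AE x in M. A u x = 0}"

definition L2_eigenspace ::
    "'a measure \<Rightarrow> (('a \<Rightarrow> real) \<Rightarrow> ('a \<Rightarrow> real)) \<Rightarrow> real \<Rightarrow> ('a \<Rightarrow> real) set" where
  "L2_eigenspace M A l = {v \<in> L2 M. AE x in M. A v x = l * v x}"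

section \<open>Sobolev spaces and elliptic measure\<close>

text \<open>\<open>\<phi> \<in> C\<^sub>c\<^sup>1(D)\<close>, extended by zero, together with its gradient \<open>d\<phi>\<close>.\<close>

definition C1c :: "(real^'n) set \<Rightarrow> (real^'n \<Rightarrow> real) \<Rightarrow> (real^'n \<Rightarrow> real^'n) \<Rightarrow> bool" where
  "C1c D \<phi> d\<phi> \<longleftrightarrow> (\<forall>x. GDERIV \<phi> x :> d\<phi> x) \<and> continuous_on UNIV d\<phi> \<and>
     compact (closure {x. \<phi> x \<noteq> 0}) \<and> closure {x. \<phi> x \<noteq> 0} \<subseteq> D"

definition L2_loc :: "(real^'n) set \<Rightarrow> (real^'n \<Rightarrow> 'b::euclidean_space) set" where
  "L2_loc D = {f \<in> borel_measurable (lebesgue_on D).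
                 \<forall>C. compact C \<and> C \<subseteq> D \<longrightarrow> f \<in> L2 (lebesgue_on C)}"

definition weak_gradient :: "(real^'n) set \<Rightarrow> (real^'n \<Rightarrow> real) \<Rightarrow> (real^'n \<Rightarrow> real^'n) \<Rightarrow> bool" where
  "weak_gradient D u g \<longleftrightarrow>
     (\<forall>\<phi> d\<phi>. C1c D \<phi> d\<phi> \<longrightarrow>
        (LINT x|lebesgue_on D. u x *\<^sub>R d\<phi> x) = - (LINT x|lebesgue_on D. \<phi> x *\<^sub>R g x))"

text \<open>In the next three predicates \<open>g\<close> is the weak gradient of \<open>u\<close>.\<close>

definition H1_loc :: "(real^'n) set \<Rightarrow> (real^'n \<Rightarrow> real) \<Rightarrow> (real^'n \<Rightarrow> real^'n) \<Rightarrow> bool" where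
  "H1_loc D u g \<longleftrightarrow> u \<in> L2_loc D \<and> g \<in> L2_loc D \<and> weak_gradient D u g"

definition H1 :: "(real^'n) set \<Rightarrow> (real^'n \<Rightarrow> real) \<Rightarrow> (real^'n \<Rightarrow> real^'n) \<Rightarrow> bool" where
  "H1 D u g \<longleftrightarrow> u \<in> L2 (lebesgue_on D) \<and> g \<in> L2 (lebesgue_on D) \<and> weak_gradient D u g"

text \<open>The closure of \<open>C\<^sub>c\<^sup>1(D)\<close> in \<open>H\<^sup>1(D)\<close>.\<close>

definition H1_0 :: "(real^'n) set \<Rightarrow> (real^'n \<Rightarrow> real) \<Rightarrow> (real^'n \<Rightarrow> real^'n) \<Rightarrow> bool" where
  "H1_0 D u g \<longleftrightarrow> H1 D u g \<and>
     (\<exists>\<phi> d\<phi>. (\<forall>n. C1c D (\<phi> n) (d\<phi> n)) \<and>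
        (\<lambda>n. LINT x|lebesgue_on D. (\<phi> n x - u x)\<^sup>2) \<longlonglongrightarrow> 0 \<and>
        (\<lambda>n. LINT x|lebesgue_on D. (norm (d\<phi> n x - g x))\<^sup>2) \<longlonglongrightarrow> 0)"

definition strictly_elliptic :: "(real^'n) set \<Rightarrow> (real^'n \<Rightarrow> real^'n^'n) \<Rightarrow> bool" where
  "strictly_elliptic D K \<longleftrightarrow> (\<exists>l0>0. \<forall>x\<in>D. \<forall>\<xi>. \<xi> \<bullet> (K x *v \<xi>) \<ge> l0 * (norm \<xi>)\<^sup>2)"

definition local_solution ::
    "(real^'n) set \<Rightarrow> (real^'n \<Rightarrow> real^'n^'n) \<Rightarrow> (real^'n \<Rightarrow> real) \<Rightarrow> bool" where
  "local_solution D K u \<longleftrightarrow> continuous_on D u \<and>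
     (\<exists>g. H1_loc D u g \<and>
        (\<forall>\<phi> d\<phi>. C1c D \<phi> d\<phi> \<longrightarrow> (LINT x|lebesgue_on D. g x \<bullet> (K x *v d\<phi> x)) = 0))"

text \<open>Regularity in the sense of Littman, Stampacchia and Weinberger: \<open>h\<close> is the variational solution
  of the Dirichlet problem with boundary data \<open>F \<in> H\<^sup>1(D) \<inter> C(closure D)\<close>.\<close>

definition regular_boundary_point ::
    "(real^'n) set \<Rightarrow> (real^'n \<Rightarrow> real^'n^'n) \<Rightarrow> real^'n \<Rightarrow> bool" where
  "regular_boundary_point D K y \<longleftrightarrow> y \<in> frontier D \<and>
     (\<forall>F dF h dh. continuous_on (closure D) F \<and> H1 D F dF \<and> local_solution D K h \<and> H1 D h dh \<and>
        H1_0 D (\<lambda>x. h x - F x) (\<lambda>x. dh x - dF x)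
        \<longrightarrow> (h \<longlongrightarrow> F y) (at y within D))"

text \<open>Boundedness is needed for uniqueness: on the punctured unit disc, where the origin is not regular,
  multiples of \<open>ln (norm x)\<close> may be added to a solution without changing the limits at the regular
  boundary points.\<close>

definition dirichlet_solution ::
    "(real^'n) set \<Rightarrow> (real^'n \<Rightarrow> real^'n^'n) \<Rightarrow> (real^'n \<Rightarrow> real) \<Rightarrow> (real^'n \<Rightarrow> real) \<Rightarrow> bool" where
  "dirichlet_solution D K f u \<longleftrightarrow> local_solution D K u \<and> bounded (u ` D) \<and>
     (\<forall>y. regular_boundary_point D K y \<longrightarrow> (u \<longlongrightarrow> f y) (at y within D))"

definition elliptic_measure ::
    "(real^'n) set \<Rightarrow> (real^'n \<Rightarrow> real^'n^'n) \<Rightarrow> real^'n \<Rightarrow> (real^'n) measure \<Rightarrow> bool" where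
  "elliptic_measure D K x \<mu> \<longleftrightarrow>
     prob_space \<mu> \<and> sets \<mu> = sets (restrict_space borel (frontier D)) \<and>
     (\<forall>f. continuous_on (frontier D) f \<longrightarrow>
        (\<exists>u. dirichlet_solution D K f u \<and> u x = (LINT y|\<mu>. f y)))"

text \<open>\<open>\<rho>\<close> is a real-valued version of the density of \<open>\<mu>\<close> with respect to \<open>\<sigma>\<close>. Existence of a density is
  not implied by absolute continuity here, since \<open>\<sigma>\<close> need not be sigma-finite.\<close>

definition real_density :: "'a measure \<Rightarrow> 'a measure \<Rightarrow> ('a \<Rightarrow> real) \<Rightarrow> bool" where
  "real_density \<sigma> \<mu> \<rho> \<longleftrightarrow> absolutely_continuous \<sigma> \<mu> \<and> \<rho> \<in> borel_measurable \<sigma> \<and>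
     (AE y in \<sigma>. 0 \<le> \<rho> y) \<and> \<mu> = density \<sigma> (\<lambda>y. ennreal (\<rho> y))"

section \<open>The operator, its adjoint and the Gram matrix\<close>

text \<open>In what follows \<open>L\<close> is the measure on the accessible boundary part and \<open>p i\<close> the density with
  pole at the \<open>i\<close>-th point. Vectors and matrices are indexed from 0, while
  eigenvalues and singular values are indexed from 1.\<close>

definition T_op :: "'a measure \<Rightarrow> nat \<Rightarrow> (nat \<Rightarrow> real) \<Rightarrow> (nat \<Rightarrow> 'a \<Rightarrow> real) \<Rightarrow>
    ('a \<Rightarrow> real) \<Rightarrow> real Matrix.vec" where
  "T_op L m \<nu> p u = Matrix.vec m (\<lambda>i. \<nu> i * (LINT x|L. u x * p i x))"

definition T_adj :: "nat \<Rightarrow> (nat \<Rightarrow> real) \<Rightarrow> (nat \<Rightarrow> 'a \<Rightarrow> real) \<Rightarrow>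
    real Matrix.vec \<Rightarrow> 'a \<Rightarrow> real" where
  "T_adj m \<nu> p v = (\<lambda>x. \<Sum>i<m. \<nu> i * v $ i * p i x)"

definition Lambda_mat :: "'a measure \<Rightarrow> nat \<Rightarrow> (nat \<Rightarrow> real) \<Rightarrow> (nat \<Rightarrow> 'a \<Rightarrow> real) \<Rightarrow>
    real Matrix.mat" where
  "Lambda_mat L m \<nu> p = Matrix.mat m m (\<lambda>(i, j). \<nu> i * \<nu> j * (LINT x|L. p i x * p j x))"

section \<open>Truncated SVD solution of the operator equation\<close>

text \<open>\<open>lam 1 \<ge> \<dots> \<ge> lam k > 0\<close> are the nonzero eigenvalues of \<open>A\<close>, each repeated according to its
  multiplicity.\<close>

definition nonzero_eigenvalues ::
    "'a measure \<Rightarrow> (('a \<Rightarrow> real) \<Rightarrow> ('a \<Rightarrow> real)) \<Rightarrow> nat \<Rightarrow> (nat \<Rightarrow> real) \<Rightarrow> bool" where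
  "nonzero_eigenvalues L A k lam \<longleftrightarrow>
     (\<forall>i\<in>{1..k}. 0 < lam i) \<and> (\<forall>i\<in>{1..k}. \<forall>j\<in>{1..k}. i \<le> j \<longrightarrow> lam j \<le> lam i) \<and>
     (\<forall>l. l \<noteq> 0 \<longrightarrow> L2_dim L (L2_eigenspace L A l) = card {i\<in>{1..k}. lam i = l})"

text \<open>The full eigenspaces of \<open>lam 1, \<dots>, lam r\<close> enter; the dimension exceeds \<open>r\<close> if
  \<open>lam r = lam (Suc r)\<close>.\<close>

definition leading_eigenspan ::
    "'a measure \<Rightarrow> (('a \<Rightarrow> real) \<Rightarrow> ('a \<Rightarrow> real)) \<Rightarrow> (nat \<Rightarrow> real) \<Rightarrow> nat \<Rightarrow> ('a \<Rightarrow> real) set" where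
  "leading_eigenspan L A lam r = L2_span L (\<Union>i\<in>{1..r}. L2_eigenspace L A (lam i))"

text \<open>A choice of one normalised eigenfunction for each of the largest \<open>r\<close> eigenvalues, counted with
  multiplicity.\<close>

definition leading_eigensystem ::
    "'a measure \<Rightarrow> (('a \<Rightarrow> real) \<Rightarrow> ('a \<Rightarrow> real)) \<Rightarrow> (nat \<Rightarrow> real) \<Rightarrow> nat \<Rightarrow>
     (nat \<Rightarrow> 'a \<Rightarrow> real) \<Rightarrow> bool" where
  "leading_eigensystem L A lam r e \<longleftrightarrow>
     (\<forall>i\<in>{1..r}. e i \<in> L2_eigenspace L A (lam i)) \<and>
     (\<forall>i\<in>{1..r}. \<forall>j\<in>{1..r}. (LINT x|L. e i x * e j x) = (if i = j then 1 else 0))"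

text \<open>\<open>ur\<close> is the projection onto \<open>W\<close> of a solution \<open>u\<close> of \<open>A u = q\<close>. For \<open>A = T\<^sup>*T\<close> and \<open>q = T\<^sup>*b\<close>
  this is the TSVD solution of \<open>T u = b\<close> with truncation space \<open>W\<close>.\<close>

definition projected_solution ::
    "'a measure \<Rightarrow> (('a \<Rightarrow> real) \<Rightarrow> ('a \<Rightarrow> real)) \<Rightarrow> ('a \<Rightarrow> real) \<Rightarrow> ('a \<Rightarrow> real) set \<Rightarrow>
     ('a \<Rightarrow> real) \<Rightarrow> bool" where
  "projected_solution L A q W ur \<longleftrightarrow>
     (\<exists>u\<in>L2 L. (AE x in L. A u x = q x) \<and> L2_proj L W u ur)"

section \<open>Truncated SVD solution of a linear system\<close>

definition orthogonal_square :: "nat \<Rightarrow> real Matrix.mat \<Rightarrow> bool" where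
  "orthogonal_square n U \<longleftrightarrow> U \<in> carrier_mat n n \<and>
     U * transpose_mat U = 1\<^sub>m n \<and> transpose_mat U * U = 1\<^sub>m n"

text \<open>\<open>rect_diag n m p a\<close> is the \<open>n \<times> m\<close> matrix with leading diagonal entries \<open>a 1, \<dots>, a p\<close> and zeros
  elsewhere.\<close>

definition rect_diag :: "nat \<Rightarrow> nat \<Rightarrow> nat \<Rightarrow> (nat \<Rightarrow> real) \<Rightarrow> real Matrix.mat" where
  "rect_diag n m p a = Matrix.mat n m (\<lambda>(i, j). if i = j \<and> i < p then a (Suc i) else 0)"

definition is_svd :: "real Matrix.mat \<Rightarrow> real Matrix.mat \<Rightarrow> (nat \<Rightarrow> real) \<Rightarrow> real Matrix.mat \<Rightarrow> bool" where
  "is_svd B U s V \<longleftrightarrow>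
     (let n = dim_row B; m = dim_col B; p = vec_space.rank n B in
        orthogonal_square n U \<and> orthogonal_square m V \<and>
        (\<forall>i\<in>{1..p}. 0 < s i) \<and> (\<forall>i\<in>{1..p}. \<forall>j\<in>{1..p}. i \<le> j \<longrightarrow> s j \<le> s i) \<and>
        B = U * rect_diag n m p s * transpose_mat V)"

definition truncated_pinv ::
    "real Matrix.mat \<Rightarrow> nat \<Rightarrow> real Matrix.mat \<Rightarrow> (nat \<Rightarrow> real) \<Rightarrow> real Matrix.mat \<Rightarrow> real Matrix.mat" where
  "truncated_pinv B r U s V =
     V * rect_diag (dim_col B) (dim_row B) r (\<lambda>i. inverse (s i)) * transpose_mat U"

text \<open>A relation and not a function of \<open>B\<close>, \<open>q\<close> and \<open>r\<close>: if the \<open>r\<close>-th and \<open>(r+1)\<close>-th singular values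
  coincide, the result depends on the chosen decomposition.\<close>

definition tsvd_solution ::
    "real Matrix.mat \<Rightarrow> real Matrix.vec \<Rightarrow> nat \<Rightarrow> real Matrix.vec \<Rightarrow> bool" where
  "tsvd_solution B q r v \<longleftrightarrow>
     1 \<le> r \<and> r \<le> vec_space.rank (dim_row B) B \<and>
     (\<exists>U s V. is_svd B U s V \<and> v = truncated_pinv B r U s V *\<^sub>v q)"

end

theory Submission
  imports Defs
begin

text \<open>Put \<open>g i = \<nu> i * \<rho> (xD i)\<close>. Then the adjoint of \<open>T\<close> is the synthesis map
  \<open>T\<^sup>* a = (\<Sum>i. a i * g i)\<close>, and \<open>T T\<^sup>*\<close> is the Gram matrix \<open>\<Lambda>\<close>, which is symmetric and
  nonnegative; hence in any singular value decomposition of \<open>\<Lambda>\<close> the left and right singular vectors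
  of positive singular values coincide and are eigenvectors. If \<open>v\<close> is a unit eigenvector of \<open>\<Lambda>\<close> for
  \<open>s > 0\<close>, then \<open>T\<^sup>* v / sqrt s\<close> is a normalised eigenfunction of \<open>T\<^sup>* T\<close> for \<open>s\<close>, and
  \<open>e \<mapsto> T e / sqrt s\<close> is the inverse correspondence, so both operators have the same positive
  eigenvalues with the same multiplicities. For a solution \<open>u\<close> of \<open>T\<^sup>* T u = T\<^sup>* b\<close> the coefficient of
  \<open>u\<close> along \<open>T\<^sup>* v / sqrt s\<close> is \<open>(v \<bullet> b) / sqrt s\<close>, so the projection of \<open>u\<close> is \<open>T\<^sup>*\<close> of the truncated
  pseudoinverse applied to \<open>b\<close>.\<close>

section \<open>Symmetric matrices in coordinates\<close>

definition dot :: "nat \<Rightarrow> (nat \<Rightarrow> real) \<Rightarrow> (nat \<Rightarrow> real) \<Rightarrow> real" where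
  "dot m a b = (\<Sum>i<m. a i * b i)"

definition matvec :: "nat \<Rightarrow> (nat \<Rightarrow> nat \<Rightarrow> real) \<Rightarrow> (nat \<Rightarrow> real) \<Rightarrow> nat \<Rightarrow> real" where
  "matvec m G v i = (\<Sum>j<m. G i j * v j)"

lemma dot_commute: "dot m a b = dot m b a"
  by (simp add: dot_def mult.commute)

lemma dot_cong: "(\<And>i. i < m \<Longrightarrow> a i = a' i) \<Longrightarrow> (\<And>i. i < m \<Longrightarrow> b i = b' i) \<Longrightarrow> dot m a b = dot m a' b'"
  by (simp add: dot_def)

lemma dot_linear:
  "dot m (\<lambda>i. a i + b i) c = dot m a c + dot m b c"
  "dot m (\<lambda>i. a i - b i) c = dot m a c - dot m b c"
  "dot m (\<lambda>i. x * a i) c = x * dot m a c"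
  "dot m c (\<lambda>i. a i + b i) = dot m c a + dot m c b"
  "dot m c (\<lambda>i. a i - b i) = dot m c a - dot m c b"
  "dot m c (\<lambda>i. x * a i) = x * dot m c a"
  by (simp_all add: dot_def algebra_simps sum.distrib sum_subtractf sum_distrib_left)

lemma dot_self_nonneg: "0 \<le> dot m a a"
  by (simp add: dot_def sum_nonneg)

lemma dot_self_eq_0: "dot m a a = 0 \<longleftrightarrow> (\<forall>i<m. a i = 0)"
  by (auto simp: dot_def sum_nonneg_eq_0_iff)

lemma matvec_linear:
  "matvec m G (\<lambda>i. a i + b i) = (\<lambda>j. matvec m G a j + matvec m G b j)"
  "matvec m G (\<lambda>i. a i - b i) = (\<lambda>j. matvec m G a j - matvec m G b j)"
  "matvec m G (\<lambda>i. x * a i) = (\<lambda>j. x * matvec m G a j)"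
  by (simp_all add: fun_eq_iff matvec_def algebra_simps sum.distrib sum_subtractf sum_distrib_left)

lemma dot_matvec_commute:
  assumes "\<And>i j. i < m \<Longrightarrow> j < m \<Longrightarrow> G i j = G j i"
  shows "dot m a (matvec m G b) = dot m (matvec m G a) b"
proof -
  have "dot m a (matvec m G b) = (\<Sum>i<m. \<Sum>j<m. a i * G i j * b j)"
    by (simp add: dot_def matvec_def sum_distrib_left mult.assoc)
  also have "\<dots> = (\<Sum>j<m. \<Sum>i<m. G j i * a i * b j)"
    using assms by (subst sum.swap) (auto intro!: sum.cong)
  also have "\<dots> = dot m (matvec m G a) b"
    by (simp add: dot_def matvec_def sum_distrib_right)
  finally show ?thesis .
qed

section \<open>Underdetermined systems and orthonormal expansions\<close>

lemma homogeneous_system_nontrivial: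
  fixes C :: "nat \<Rightarrow> nat \<Rightarrow> real"
  assumes "m < n"
  obtains c where "\<exists>i<n. c i \<noteq> 0" "\<And>j. j < m \<Longrightarrow> (\<Sum>i<n. c i * C i j) = 0"
proof -
  \<comment> \<open>The equations are padded with zero rows to a square system. Row
    \<open>m\<close>, which exists because \<open>m < n\<close>, is literally
    \<open>0\<^sub>v n\<close>, so the determinant vanishes.\<close>
  let ?B = "mat\<^sub>r n n (\<lambda>j. if j = m then 0\<^sub>v n else Matrix.vec n (\<lambda>i. if j < m then C i j else 0))"
  have "det ?B = 0"
    by (rule det_row_0) (use assms in auto)
  then obtain v where v: "v \<in> carrier_vec n" "v \<noteq> 0\<^sub>v n" "?B *\<^sub>v v = 0\<^sub>v n"
    using det_0_iff_vec_prod_zero_field[of ?B n] by auto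
  have "\<exists>i<n. v $ i \<noteq> 0"
    using v(1,2) by (metis carrier_vecD eq_vecI index_zero_vec(1,2))
  moreover have "(\<Sum>i<n. v $ i * C i j) = 0" if "j < m" for j
  proof -
    have "(?B *\<^sub>v v) $ j = 0" using v(3) that assms by simp
    moreover have "row ?B j = Matrix.vec n (\<lambda>i. C i j)"
      using that assms by (subst row_mat_of_row_fun) auto
    ultimately show ?thesis using that assms v(1)
      by (simp add: scalar_prod_def atLeast0LessThan mult.commute)
  qed
  ultimately show ?thesis using that[of "\<lambda>i. v $ i"] by blast
qed

text \<open>Orthonormality says that the transpose of the matrix with columns \<open>v i\<close> is
  its left inverse. For a square matrix it is then also a right inverse, and the entries of that
  identity are the completeness relation.\<close>

lemma orthonormal_expansion:
  assumes orth: "\<And>i j. i < m \<Longrightarrow> j < m \<Longrightarrow> dot m (v i) (v j) = (if i = j then 1 else 0)"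
    and t: "t < m"
  shows "a t = (\<Sum>i<m. dot m a (v i) * v i t)"
proof -
  let ?V = "Matrix.mat m m (\<lambda>(t, i). v i t)"
  have "transpose_mat ?V * ?V = 1\<^sub>m m"
    using orth by (intro eq_matI) (auto simp: scalar_prod_def dot_def atLeast0LessThan)
  then have VV: "?V * transpose_mat ?V = 1\<^sub>m m"
    by (intro mat_mult_left_right_inverse[of "transpose_mat ?V" m ?V]) auto
  have id: "(\<Sum>i<m. v i s * v i t) = (if s = t then 1 else 0)" if "s < m" for s
  proof -
    have "(?V * transpose_mat ?V) $$ (s, t) = (if s = t then 1 else 0)"
      using VV that t by simp
    then show ?thesis using that t by (simp add: scalar_prod_def atLeast0LessThan)
  qed
  have "(\<Sum>i<m. dot m a (v i) * v i t) = (\<Sum>i<m. \<Sum>s<m. a s * (v i s * v i t))"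
    by (simp add: dot_def sum_distrib_right mult.assoc)
  also have "\<dots> = (\<Sum>s<m. a s * (\<Sum>i<m. v i s * v i t))"
    by (subst sum.swap) (simp add: sum_distrib_left)
  also have "\<dots> = a t" using t by (simp add: id if_distrib cong: if_cong)
  finally show ?thesis by simp
qed

lemma dot_orthonormal_sum:
  fixes n :: nat
  assumes "\<And>i j. i < n \<Longrightarrow> j < n \<Longrightarrow> dot m (v i) (v j) = (if i = j then 1 else 0)" "j < n"
  shows "dot m (\<lambda>t. \<Sum>i<n. c i * v i t) (v j) = c j"
proof -
  have "dot m (\<lambda>t. \<Sum>i<n. c i * v i t) (v j) = (\<Sum>i<n. c i * dot m (v i) (v j))"
    unfolding dot_def sum_distrib_right sum_distrib_left
    by (subst sum.swap) (simp add: mult.assoc)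
  also have "\<dots> = (\<Sum>i<n. if i = j then c i else 0)" using assms by (intro sum.cong) auto
  also have "\<dots> = c j" using assms(2) by simp
  finally show ?thesis .
qed

section \<open>Eigenvectors by successive maximisation of the quadratic form\<close>

lemma nonneg_quadratic_linear_coeff_0:
  fixes a b :: real
  assumes "\<And>t. 0 \<le> 2 * t * a + t\<^sup>2 * b"
  shows "a = 0"
proof (rule ccontr)
  assume a: "a \<noteq> 0"
  \<comment> \<open>At \<open>t = - a / N\<close> the polynomial is
    \<open>(a\<^sup>2 / N) * (b / N - 2)\<close>, and \<open>b \<le> N\<close> makes the last factor
    at most -1.\<close>
  define N where "N = \<bar>b\<bar> + 1"
  have N: "N > 0" "b \<le> N" "b < N" by (auto simp: N_def)
  have "0 \<le> 2 * (- a / N) * a + (- a / N)\<^sup>2 * b" by (rule assms)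
  also have "\<dots> = (a\<^sup>2 / N) * (b / N - 2)"
    using N by (simp add: field_simps power2_eq_square)
  finally have "0 \<le> (a\<^sup>2 / N) * (b / N - 2)" .
  moreover have "a\<^sup>2 / N > 0" using a N by simp
  moreover have "b / N \<le> 1" using N by simp
  ultimately show False by (smt (verit) mult_pos_neg)
qed

text \<open>Vectors are functions on all naturals, so the coordinates from \<open>m\<close> on are
  fixed at 0. The set is then a closed subset of a product of intervals and singletons, which is
  compact by Tychonoff.\<close>

lemma compact_sphere_orthogonal:
  "compact {x :: nat \<Rightarrow> real. (\<forall>i. m \<le> i \<longrightarrow> x i = 0) \<and> dot m x x = 1 \<and> (\<forall>i<j. dot m x (v i) = 0)}"
    (is "compact ?S")
proof -
  let ?I = "\<lambda>i. if i < m then {-1..1 :: real} else {0}"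
  have "compactin (product_topology (\<lambda>i. euclidean) UNIV) (PiE UNIV ?I)"
    by (subst compactin_PiE) auto
  then have "compact (PiE UNIV ?I)"
    by (simp add: euclidean_product_topology)
  moreover have "closed {x :: nat \<Rightarrow> real. dot m x x = 1 \<and> (\<forall>i<j. dot m x (v i) = 0)}"
    unfolding dot_def
    by (intro closed_Collect_conj closed_Collect_all closed_Collect_imp closed_Collect_eq
        continuous_intros open_Collect_const continuous_on_product_coordinates)
  ultimately have "compact (PiE UNIV ?I \<inter> {x :: nat \<Rightarrow> real. dot m x x = 1 \<and> (\<forall>i<j. dot m x (v i) = 0)})"
    by (rule compact_Int_closed)
  also have "PiE UNIV ?I \<inter> {x :: nat \<Rightarrow> real. dot m x x = 1 \<and> (\<forall>i<j. dot m x (v i) = 0)} = ?S"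
  proof -
    have "\<bar>x i\<bar> \<le> 1" if "dot m x x = 1" "i < m" for x i
    proof -
      have "(x i)\<^sup>2 \<le> (\<Sum>i<m. (x i)\<^sup>2)"
        using that(2) by (intro member_le_sum) auto
      then show ?thesis using that(1) by (simp add: dot_def abs_square_le_1 flip: power2_eq_square)
    qed
    then have "x i \<in> ?I i" if "\<forall>i. m \<le> i \<longrightarrow> x i = 0" "dot m x x = 1" for x i
      using that by (cases "i < m") (auto simp: abs_le_iff minus_le_iff)
    moreover have "x i = 0" if "x \<in> PiE UNIV ?I" "m \<le> i" for x i
      using PiE_mem[OF that(1), of i] that(2) by simp
    ultimately show ?thesis by blast
  qed
  finally show ?thesis .
qed


text \<open>The quadratic form of \<open>G\<close> is maximised over the unit sphere in the
  orthogonal complement of the known eigenvectors; the maximiser is an eigenvector because that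
  complement is invariant under \<open>G\<close>. The final bound on the complement later puts the
  eigenvalues in decreasing order.\<close>

lemma exists_next_eigenvector:
  assumes sym: "\<And>i j. i < m \<Longrightarrow> j < m \<Longrightarrow> G i j = G j i"
    and j: "j < m"
    and eig: "\<And>i t. i < j \<Longrightarrow> t < m \<Longrightarrow> matvec m G (v i) t = c i * v i t"
  obtains x \<mu> where "dot m x x = 1" "\<And>i. i < j \<Longrightarrow> dot m x (v i) = 0"
    "\<And>t. t < m \<Longrightarrow> matvec m G x t = \<mu> * x t"
    "\<And>y. (\<And>i. i < j \<Longrightarrow> dot m y (v i) = 0) \<Longrightarrow> dot m y (matvec m G y) \<le> \<mu> * dot m y y"
proof -
  let ?S = "{x :: nat \<Rightarrow> real. (\<forall>i. m \<le> i \<longrightarrow> x i = 0) \<and> dot m x x = 1 \<and> (\<forall>i<j. dot m x (v i) = 0)}"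
  let ?q = "\<lambda>y. dot m y (matvec m G y)"
  \<comment> \<open>Besides normalising, \<open>?restr\<close> cuts off the coordinates from
    \<open>m\<close> on, as membership in \<open>?S\<close> demands; \<open>dot m\<close> and
    \<open>matvec m\<close> do not see the cut.\<close>
  let ?restr = "\<lambda>y :: nat \<Rightarrow> real. \<lambda>t. (1 / sqrt (dot m y y)) * (if t < m then y t else 0)"
  have normalised: "?restr y \<in> ?S" "?q (?restr y) = ?q y / dot m y y"
    if "dot m y y \<noteq> 0" "\<And>i. i < j \<Longrightarrow> dot m y (v i) = 0" for y
  proof -
    have pos: "dot m y y > 0" using that(1) dot_self_nonneg[of m y] by simp
    let ?z = "\<lambda>t. if t < m then y t else 0"
    have z: "dot m ?z a = dot m y a" "dot m a ?z = dot m a y" "matvec m G ?z = matvec m G y" for a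
      by (auto intro!: dot_cong sum.cong simp: matvec_def)
    have "dot m (?restr y) (?restr y) = 1 / sqrt (dot m y y) * (1 / sqrt (dot m y y) * dot m y y)"
      by (simp only: dot_linear z)
    moreover have "dot m (?restr y) (v i) = 0" if "i < j" for i
      using \<open>\<And>i. i < j \<Longrightarrow> dot m y (v i) = 0\<close>[OF that] by (simp only: dot_linear z)
    ultimately show "?restr y \<in> ?S" using pos by (simp add: field_simps)
    have "?q (?restr y) = 1 / sqrt (dot m y y) * (1 / sqrt (dot m y y) * ?q y)"
      by (simp only: dot_linear matvec_linear z)
    then show "?q (?restr y) = ?q y / dot m y y" using pos by (simp add: field_simps)
  qed
  \<comment> \<open>Fewer than \<open>m\<close> orthogonality conditions leave a nonzero vector, so
    the sphere is nonempty.\<close>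
  obtain y where y: "\<exists>i<m. y i \<noteq> 0" "\<And>i. i < j \<Longrightarrow> (\<Sum>t<m. y t * v i t) = 0"
    using homogeneous_system_nontrivial[OF j, of "\<lambda>t i. v i t"] by metis
  then have "dot m y y \<noteq> 0" "\<And>i. i < j \<Longrightarrow> dot m y (v i) = 0"
    by (auto simp: dot_self_eq_0, simp add: dot_def)
  then have "?S \<noteq> {}" using normalised(1) by (metis (no_types, lifting) empty_iff)
  moreover have "continuous_on ?S ?q"
    unfolding dot_def matvec_def
    by (intro continuous_intros continuous_on_subset[OF continuous_on_product_coordinates] subset_UNIV)
  ultimately have "\<exists>x\<in>?S. \<forall>y\<in>?S. ?q y \<le> ?q x"
    by (intro continuous_attains_sup compact_sphere_orthogonal)
  then obtain x where x: "x \<in> ?S" "\<And>y. y \<in> ?S \<Longrightarrow> ?q y \<le> ?q x" by blast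
  define \<mu> where "\<mu> = ?q x"
  have x1: "dot m x x = 1" and xorth: "\<And>i. i < j \<Longrightarrow> dot m x (v i) = 0" using x(1) by auto
  have bound: "?q y \<le> \<mu> * dot m y y" if "\<And>i. i < j \<Longrightarrow> dot m y (v i) = 0" for y
  proof (cases "dot m y y = 0")
    case True
    then have "?q y = 0" unfolding dot_self_eq_0 by (simp add: dot_def)
    then show ?thesis using True by simp
  next
    case False
    then have "?q y / dot m y y \<le> \<mu>"
      using x(2)[OF normalised(1)[OF False that]] normalised(2)[OF False that] by (simp add: \<mu>_def)
    then show ?thesis using False dot_self_nonneg[of m y] by (simp add: field_simps)
  qed
  \<comment> \<open>The form \<open>\<mu> |y|\<^sup>2 - y \<bullet> G y\<close> is nonnegative on the orthogonal complement and vanishes at \<open>x\<close>,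
    so \<open>x\<close> is in its radical.\<close>
  define z where "z = (\<lambda>t. \<mu> * x t - matvec m G x t)"
  have zorth: "dot m z y = 0" if "\<And>i. i < j \<Longrightarrow> dot m y (v i) = 0" for y
  proof (rule nonneg_quadratic_linear_coeff_0)
    fix t :: real
    let ?w = "\<lambda>i. x i + t * y i"
    have le: "?q ?w \<le> \<mu> * dot m ?w ?w"
      using that xorth by (intro bound) (simp add: dot_linear)
    have "dot m x (matvec m G y) = dot m (matvec m G x) y"
      using sym by (rule dot_matvec_commute)
    then have q: "?q ?w = \<mu> + 2 * t * dot m (matvec m G x) y + t\<^sup>2 * ?q y"
      by (simp add: matvec_linear dot_linear \<mu>_def dot_commute[of m y "matvec m G x"] algebra_simps power2_eq_square)
    have w: "dot m ?w ?w = 1 + 2 * t * dot m x y + t\<^sup>2 * dot m y y"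
      by (simp add: dot_linear x1 dot_commute[of m y x] algebra_simps power2_eq_square)
    show "0 \<le> 2 * t * dot m z y + t\<^sup>2 * (\<mu> * dot m y y - ?q y)"
      using le[unfolded q w] by (simp add: z_def dot_linear algebra_simps)
  qed
  \<comment> \<open>Symmetry moves \<open>G\<close> onto the eigenvector \<open>v i\<close>; hence
    \<open>z\<close> stays in the complement and \<open>zorth\<close> can be applied to
    \<open>z\<close> itself.\<close>
  have "dot m (matvec m G x) (v i) = 0" if "i < j" for i
  proof -
    have "dot m (matvec m G x) (v i) = dot m x (matvec m G (v i))"
      using dot_matvec_commute[OF sym] by simp
    also have "\<dots> = dot m x (\<lambda>t. c i * v i t)"
      using eig[OF that] by (intro dot_cong) auto
    finally show ?thesis using xorth[OF that] by (simp add: dot_linear)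
  qed
  then have "dot m z (v i) = 0" if "i < j" for i
    using that xorth by (simp add: z_def dot_linear)
  then have "dot m z z = 0" by (rule zorth)
  then have "\<And>t. t < m \<Longrightarrow> matvec m G x t = \<mu> * x t"
    by (simp add: dot_self_eq_0 z_def)
  then show ?thesis using that x1 xorth bound by blast
qed

text \<open>Each new eigenvalue maximises the form over a smaller complement than the previous one,
  so the new ones decrease. The prescribed \<open>c i\<close> may come in any order and are not
  compared with the new ones.\<close>

lemma extend_eigenvectors:
  assumes sym: "\<And>i j. i < m \<Longrightarrow> j < m \<Longrightarrow> G i j = G j i"
    and orth: "\<And>i j. i < r \<Longrightarrow> j < r \<Longrightarrow> dot m (v i) (v j) = (if i = j then 1 else 0)"
    and eig: "\<And>i t. i < r \<Longrightarrow> t < m \<Longrightarrow> matvec m G (v i) t = c i * v i t"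
    and r: "r \<le> m"
  obtains v' c' where "\<And>i. i < r \<Longrightarrow> v' i = v i" "\<And>i. i < r \<Longrightarrow> c' i = c i"
    "\<And>i j. i < m \<Longrightarrow> j < m \<Longrightarrow> dot m (v' i) (v' j) = (if i = j then 1 else 0)"
    "\<And>i t. i < m \<Longrightarrow> t < m \<Longrightarrow> matvec m G (v' i) t = c' i * v' i t"
    "\<And>i j. r \<le> i \<Longrightarrow> i \<le> j \<Longrightarrow> j < m \<Longrightarrow> c' j \<le> c' i"
proof -
  \<comment> \<open>The last clause carries the maximality of every new eigenvalue on the current
    complement, from which the next step gets the order. At \<open>n = r\<close> the last two
    clauses are vacuous.\<close>
  define P where "P = (\<lambda>n v' c'. (\<forall>i<r. v' i = v i \<and> c' i = c i) \<and>
     (\<forall>i<n. \<forall>j<n. dot m (v' i) (v' j) = (if i = j then 1 else 0)) \<and>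
     (\<forall>i<n. \<forall>t<m. matvec m G (v' i) t = c' i * v' i t) \<and>
     (\<forall>i j. r \<le> i \<and> i \<le> j \<and> j < n \<longrightarrow> c' j \<le> c' i) \<and>
     (\<forall>i y. r \<le> i \<and> i < n \<and> (\<forall>j<n. dot m y (v' j) = 0) \<longrightarrow> dot m y (matvec m G y) \<le> c' i * dot m y y))"
  have "\<exists>v' c'. P n v' c'" if "r \<le> n" "n \<le> m" for n
    using that
  proof (induction n rule: dec_induct)
    case base
    show ?case using orth eig by (intro exI[of _ v] exI[of _ c]) (auto simp: P_def)
  next
    case (step n)
    then obtain v' c' where P: "P n v' c'" by auto
    have agree: "\<And>i. i < r \<Longrightarrow> v' i = v i" "\<And>i. i < r \<Longrightarrow> c' i = c i"
      and orth': "\<And>i k. i < n \<Longrightarrow> k < n \<Longrightarrow> dot m (v' i) (v' k) = (if i = k then 1 else 0)"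
      and eig': "\<And>i t. i < n \<Longrightarrow> t < m \<Longrightarrow> matvec m G (v' i) t = c' i * v' i t"
      and dec: "\<And>i k. r \<le> i \<Longrightarrow> i \<le> k \<Longrightarrow> k < n \<Longrightarrow> c' k \<le> c' i"
      and bnd: "\<And>i y. r \<le> i \<Longrightarrow> i < n \<Longrightarrow> (\<And>k. k < n \<Longrightarrow> dot m y (v' k) = 0) \<Longrightarrow>
        dot m y (matvec m G y) \<le> c' i * dot m y y"
      using P unfolding P_def by blast+
    obtain x \<mu> where x: "dot m x x = 1" "\<And>i. i < n \<Longrightarrow> dot m x (v' i) = 0"
      "\<And>t. t < m \<Longrightarrow> matvec m G x t = \<mu> * x t"
      "\<And>y. (\<And>i. i < n \<Longrightarrow> dot m y (v' i) = 0) \<Longrightarrow> dot m y (matvec m G y) \<le> \<mu> * dot m y y"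
    proof (rule exists_next_eigenvector[of m G n v' c'])
      show "n < m" using step.prems by simp
    qed (use sym eig' that in blast)+
    have "dot m x (matvec m G x) = \<mu>"
      using dot_cong[of m x x "matvec m G x" "\<lambda>t. \<mu> * x t"] x by (simp add: dot_linear)
    \<comment> \<open>The new \<open>x\<close> lies in the complement on which the earlier new
      eigenvalues bound the form.\<close>
    then have le: "\<mu> \<le> c' i" if "r \<le> i" "i < n" for i
      using bnd[OF that x(2)] x(1) by simp
    define w e where "w = v'(n := x)" and "e = c'(n := \<mu>)"
    have new: "w n = x" "e n = \<mu>" and old: "\<And>i. i < n \<Longrightarrow> w i = v' i" "\<And>i. i < n \<Longrightarrow> e i = c' i"
      by (simp_all add: w_def e_def)
    have P1: "w i = v i \<and> e i = c i" if "i < r" for i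
    proof -
      have "i < n" using that step.hyps(1) by (rule less_le_trans)
      then show ?thesis using agree[OF that] old[of i] by metis
    qed
    have P2: "dot m (w i) (w k) = (if i = k then 1 else 0)" if "i < Suc n" "k < Suc n" for i k
    proof (cases "i = n"; cases "k = n")
      assume "i = n" "k \<noteq> n"
      then show ?thesis using that x(2)[of k] new(1) old(1)[of k] by simp
    next
      assume "i \<noteq> n" "k = n"
      then show ?thesis using that x(2)[of i] new(1) old(1)[of i] by (simp add: dot_commute[of m _ x])
    next
      assume "i \<noteq> n" "k \<noteq> n"
      then show ?thesis using that orth'[of i k] old(1)[of i] old(1)[of k] by simp
    qed (use x(1) new(1) in simp)
    have P3: "matvec m G (w i) t = e i * w i t" if "i < Suc n" "t < m" for i t
      using that x(3)[of t] eig'[of i t] new old[of i] by (cases "i = n") simp_all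
    have P4: "e k \<le> e i" if "r \<le> i" "i \<le> k" "k < Suc n" for i k
    proof (cases "k = n")
      case True
      then show ?thesis using that(1) le[of i] new(2) old(2)[of i] that(2) by (cases "i = n") simp_all
    next
      case False
      then show ?thesis using that dec[of i k] old(2)[of i] old(2)[of k] by simp
    qed
    have P5: "dot m y (matvec m G y) \<le> e i * dot m y y"
      if "r \<le> i" "i < Suc n" and y: "\<forall>k<Suc n. dot m y (w k) = 0" for i y
    proof -
      have "dot m y (v' k) = 0" if "k < n" for k
        using y[rule_format, of k] that old(1)[of k] by simp
      then show ?thesis
        using bnd[of i y] x(4)[of y] that(1,2) new old(2)[of i] by (cases "i = n") simp_all
    qed
    have "P (Suc n) w e" unfolding P_def
      by (intro conjI allI impI; (elim conjE)?; rule P1[THEN conjunct1] P1[THEN conjunct2] P2 P3 P4 P5; assumption)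
    then show ?case by blast
  qed
  then obtain v' c' where "P m v' c'" using r by blast
  then show ?thesis by (intro that[of v' c']) (auto simp: P_def)
qed

section \<open>Square integrable functions\<close>

definition ip :: "'a measure \<Rightarrow> ('a \<Rightarrow> real) \<Rightarrow> ('a \<Rightarrow> real) \<Rightarrow> real" where
  "ip L f h = (LINT x|L. f x * h x)"

lemma L2_real_iff: "(f :: 'a \<Rightarrow> real) \<in> L2 L \<longleftrightarrow> f \<in> borel_measurable L \<and> integrable L (\<lambda>x. (f x)\<^sup>2)"
  by (simp add: L2_def)

lemma L2_mult_integrable:
  fixes f h :: "'a \<Rightarrow> real"
  assumes "f \<in> L2 L" "h \<in> L2 L"
  shows "integrable L (\<lambda>x. f x * h x)"
proof (rule Bochner_Integration.integrable_bound)
  show "integrable L (\<lambda>x. (f x)\<^sup>2 + (h x)\<^sup>2)" using assms by (simp add: L2_real_iff)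
  show "(\<lambda>x. f x * h x) \<in> borel_measurable L" using assms by (auto simp: L2_real_iff)
  have "\<bar>a * c\<bar> \<le> a\<^sup>2 + c\<^sup>2" for a c :: real
    using sum_squares_bound[of a c] sum_squares_bound[of a "- c"] zero_le_power2[of a] zero_le_power2[of c]
    by (simp add: abs_le_iff)
  then show "AE x in L. norm (f x * h x) \<le> norm ((f x)\<^sup>2 + (h x)\<^sup>2)" by simp
qed

lemma L2_add: "f \<in> L2 L \<Longrightarrow> h \<in> L2 L \<Longrightarrow> (\<lambda>x. f x + h x) \<in> L2 L" for f h :: "'a \<Rightarrow> real"
  using L2_mult_integrable[of f L h] by (auto simp: L2_real_iff power2_sum mult.assoc)

lemma L2_cmult: "f \<in> L2 L \<Longrightarrow> (\<lambda>x. c * f x) \<in> L2 L" for f :: "'a \<Rightarrow> real"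
  by (auto simp: L2_real_iff power_mult_distrib)

lemma L2_diff: "f \<in> L2 L \<Longrightarrow> h \<in> L2 L \<Longrightarrow> (\<lambda>x. f x - h x) \<in> L2 L" for f h :: "'a \<Rightarrow> real"
  using L2_add[of f L "\<lambda>x. - 1 * h x"] L2_cmult[of h L "- 1"] by simp

lemma L2_sum:
  fixes f :: "'i \<Rightarrow> 'a \<Rightarrow> real"
  assumes "\<And>i. i \<in> I \<Longrightarrow> f i \<in> L2 L"
  shows "(\<lambda>x. \<Sum>i\<in>I. c i * f i x) \<in> L2 L"
  using assms
proof (induction I rule: infinite_finite_induct)
  case (insert i I)
  then show ?case using L2_add[OF L2_cmult[of "f i" L "c i"]] by simp
qed (simp_all add: L2_real_iff)

lemma ip_commute: "ip L f h = ip L h f"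
  by (simp add: ip_def mult.commute)

lemma ip_diff:
  "f \<in> L2 L \<Longrightarrow> f' \<in> L2 L \<Longrightarrow> h \<in> L2 L \<Longrightarrow> ip L (\<lambda>x. f x - f' x) h = ip L f h - ip L f' h"
  by (simp add: ip_def left_diff_distrib L2_mult_integrable)

lemma ip_cmult: "ip L (\<lambda>x. c * f x) h = c * ip L f h" "ip L h (\<lambda>x. c * f x) = c * ip L h f"
  by (simp_all add: ip_def mult.left_commute mult.assoc)

lemma ip_sum:
  assumes "\<And>i. i \<in> I \<Longrightarrow> f i \<in> L2 L" "h \<in> L2 L"
  shows "ip L (\<lambda>x. \<Sum>i\<in>I. c i * f i x) h = (\<Sum>i\<in>I. c i * ip L (f i) h)"
proof -
  have "ip L (\<lambda>x. \<Sum>i\<in>I. c i * f i x) h = (LINT x|L. (\<Sum>i\<in>I. c i * (f i x * h x)))"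
    by (simp add: ip_def sum_distrib_right mult.assoc)
  also have "\<dots> = (\<Sum>i\<in>I. c i * ip L (f i) h)"
    unfolding ip_def using assms
    by (subst Bochner_Integration.integral_sum) (auto intro: L2_mult_integrable)
  finally show ?thesis .
qed

lemma ip_cong_AE:
  assumes "AE x in L. f x = f' x" "f \<in> L2 L" "f' \<in> L2 L" "h \<in> L2 L"
  shows "ip L f h = ip L f' h"
  unfolding ip_def using assms
  by (intro integral_cong_AE) (auto simp: L2_real_iff)

lemma ip_self_eq_0:
  assumes "f \<in> L2 L" "ip L f f = 0"
  shows "AE x in L. f x = 0"
proof -
  have "AE x in L. (f x)\<^sup>2 = 0"
    using assms integral_nonneg_eq_0_iff_AE[of L "\<lambda>x. (f x)\<^sup>2"]
    by (simp add: L2_real_iff ip_def power2_eq_square)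
  then show ?thesis by simp
qed

section \<open>Finite combinations and dimension modulo null functions\<close>

lemma AE_sum_cong:
  fixes f h :: "'i \<Rightarrow> 'a \<Rightarrow> real"
  assumes "finite I" "\<And>i. i \<in> I \<Longrightarrow> AE x in L. f i x = h i x"
  shows "AE x in L. (\<Sum>i\<in>I. c i * f i x) = (\<Sum>i\<in>I. c i * h i x)"
proof -
  have "AE x in L. \<forall>i\<in>I. f i x = h i x" using assms by (subst AE_finite_all) auto
  then show ?thesis by eventually_elim simp
qed

text \<open>Steinitz argument: if \<open>n\<close> independent functions were combinations of
  \<open>m < n\<close> spanning ones, a nontrivial relation between the coefficient rows would
  contradict independence. By symmetry the dimension is unique, as the \<open>THE\<close> in
  \<open>L2_dim\<close> requires.\<close>

lemma L2_has_dim_le: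
  assumes "L2_has_dim L S n" "L2_has_dim L S m"
  shows "n \<le> m"
proof (rule ccontr)
  assume "\<not> n \<le> m"
  then have "m < n" by simp
  obtain e where e: "\<forall>i<n. e i \<in> S" "\<forall>c. (AE x in L. (\<Sum>i<n. c i * e i x) = 0) \<longrightarrow> (\<forall>i<n. c i = 0)"
    using assms(1) unfolding L2_has_dim_def by (elim exE conjE)
  obtain f where f: "\<forall>h\<in>S. \<exists>c. AE x in L. h x = (\<Sum>j<m. c j * f j x)"
    using assms(2) unfolding L2_has_dim_def by (elim exE conjE)
  have "\<forall>i\<in>{..<n}. \<exists>c. AE x in L. e i x = (\<Sum>j<m. c j * f j x)" using e(1) f by simp
  from bchoice[OF this] obtain C where
    C: "\<And>i. i < n \<Longrightarrow> AE x in L. e i x = (\<Sum>j<m. C i j * f j x)" by auto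
  obtain c where c: "\<exists>i<n. c i \<noteq> 0" "\<And>j. j < m \<Longrightarrow> (\<Sum>i<n. c i * C i j) = 0"
    using homogeneous_system_nontrivial[OF \<open>m < n\<close>] by metis
  have "AE x in L. (\<Sum>i<n. c i * e i x) = (\<Sum>i<n. c i * (\<Sum>j<m. C i j * f j x))"
    by (rule AE_sum_cong) (use C in auto)
  moreover have "(\<Sum>i<n. c i * (\<Sum>j<m. C i j * f j x)) = 0" for x
  proof -
    have "(\<Sum>i<n. c i * (\<Sum>j<m. C i j * f j x)) = (\<Sum>j<m. (\<Sum>i<n. c i * C i j) * f j x)"
      unfolding sum_distrib_left sum_distrib_right by (subst sum.swap) (simp add: mult.assoc)
    then show ?thesis using c(2) by simp
  qed
  ultimately have "AE x in L. (\<Sum>i<n. c i * e i x) = 0" by (simp only:)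
  with e(2) have "\<forall>i<n. c i = 0" by blast
  with c(1) show False by blast
qed

lemma L2_dim_eqI: "L2_has_dim L S n \<Longrightarrow> L2_dim L S = n"
  unfolding L2_dim_def by (intro the_equality) (auto intro: antisym L2_has_dim_le)

section \<open>The frame operator and its eigenfunctions\<close>

text \<open>The family will be \<open>g i = \<nu> i * \<rho> (xD i)\<close>. Then
  \<open>analysis\<close> is the operator T, \<open>synthesis\<close> its adjoint,
  \<open>frame_op\<close> the adjoint composed with T, and \<open>gram\<close> the matrix
  \<Lambda>.\<close>

locale l2_frame =
  fixes L :: "'a measure" and m :: nat and g :: "nat \<Rightarrow> 'a \<Rightarrow> real"
  assumes g_L2: "i < m \<Longrightarrow> g i \<in> L2 L"
begin

definition gram :: "nat \<Rightarrow> nat \<Rightarrow> real" where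
  "gram i j = ip L (g i) (g j)"

definition synthesis :: "(nat \<Rightarrow> real) \<Rightarrow> 'a \<Rightarrow> real" where
  "synthesis a = (\<lambda>x. \<Sum>i<m. a i * g i x)"

definition analysis :: "('a \<Rightarrow> real) \<Rightarrow> nat \<Rightarrow> real" where
  "analysis u = (\<lambda>i. ip L u (g i))"

definition frame_op :: "('a \<Rightarrow> real) \<Rightarrow> 'a \<Rightarrow> real" where
  "frame_op u = synthesis (analysis u)"

lemma gram_sym: "gram i j = gram j i"
  by (simp add: gram_def ip_commute)

lemma synthesis_L2: "synthesis a \<in> L2 L"
  unfolding synthesis_def by (rule L2_sum) (simp add: g_L2)

lemma frame_op_L2: "frame_op u \<in> L2 L"
  by (simp add: frame_op_def synthesis_L2)

lemma synthesis_cong: "(\<And>i. i < m \<Longrightarrow> a i = b i) \<Longrightarrow> synthesis a = synthesis b"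
  by (simp add: synthesis_def)

lemma synthesis_cmult: "synthesis (\<lambda>t. c * a t) = (\<lambda>x. c * synthesis a x)"
  by (simp add: synthesis_def sum_distrib_left mult.assoc)

lemma synthesis_sum: "synthesis (\<lambda>t. \<Sum>i\<in>I. c i * v i t) = (\<lambda>x. \<Sum>i\<in>I. c i * synthesis (v i) x)"
  unfolding synthesis_def sum_distrib_left sum_distrib_right
  by (subst sum.swap) (simp add: mult.assoc)

lemma ip_synthesis_left: "u \<in> L2 L \<Longrightarrow> ip L (synthesis a) u = dot m a (analysis u)"
  unfolding synthesis_def by (subst ip_sum) (simp_all add: g_L2 dot_def analysis_def ip_commute[of L u])

lemma ip_synthesis_right: "u \<in> L2 L \<Longrightarrow> ip L u (synthesis a) = dot m (analysis u) a"
  by (simp add: ip_commute[of L u] ip_synthesis_left dot_commute)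

text \<open>T composed with its adjoint is the Gram matrix; this links the spectra of
  \<open>frame_op\<close> and \<open>gram\<close>.\<close>

lemma analysis_synthesis: "i < m \<Longrightarrow> analysis (synthesis a) i = matvec m gram a i"
  by (simp add: analysis_def ip_commute[of L _ "g i"] ip_synthesis_right g_L2)
    (simp add: dot_def matvec_def analysis_def gram_def)

lemma ip_synthesis_synthesis: "ip L (synthesis a) (synthesis b) = dot m a (matvec m gram b)"
  by (simp add: ip_synthesis_left synthesis_L2 analysis_synthesis cong: dot_cong)

text \<open>Both inner products reduce to the same coordinate product, so this contains the
  self-adjointness of \<open>frame_op\<close>.\<close>

lemma ip_frame_op:
  assumes "u \<in> L2 L" "h \<in> L2 L"
  shows "ip L (frame_op u) h = dot m (analysis u) (analysis h)"
    "ip L u (frame_op h) = dot m (analysis u) (analysis h)"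
  using assms by (simp_all add: frame_op_def ip_synthesis_left ip_synthesis_right)

lemma analysis_cong_AE:
  assumes "AE x in L. u x = h x" "u \<in> L2 L" "h \<in> L2 L" "i < m"
  shows "analysis u i = analysis h i"
  unfolding analysis_def using assms by (intro ip_cong_AE) (auto simp: g_L2)

text \<open>The form is the squared norm of \<open>synthesis a\<close>.\<close>

lemma dot_gram_nonneg: "0 \<le> dot m a (matvec m gram a)"
proof -
  have "0 \<le> ip L (synthesis a) (synthesis a)"
    unfolding ip_def by (simp add: integral_nonneg_AE)
  then show ?thesis by (simp add: ip_synthesis_synthesis)
qed

text \<open>\<open>v 0, \<dots>, v (m - 1)\<close> are eigenvectors, but \<open>s 1, \<dots>, s p\<close> are eigenvalues, matching the
  index conventions of \<^const>\<open>is_svd\<close>.\<close>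

definition eigenbasis :: "(nat \<Rightarrow> nat \<Rightarrow> real) \<Rightarrow> (nat \<Rightarrow> real) \<Rightarrow> nat \<Rightarrow> bool" where
  "eigenbasis v s p \<longleftrightarrow> p \<le> m \<and> (\<forall>i\<in>{1..p}. 0 < s i) \<and>
     (\<forall>i<m. \<forall>j<m. dot m (v i) (v j) = (if i = j then 1 else 0)) \<and>
     (\<forall>i<m. \<forall>t<m. matvec m gram (v i) t = (if i < p then s (Suc i) else 0) * v i t)"

end

section \<open>Eigenfunctions of \<open>frame_op\<close> from an eigenbasis of
  \<open>gram\<close>\<close>

locale l2_frame_eigenbasis = l2_frame +
  fixes v :: "nat \<Rightarrow> nat \<Rightarrow> real" and s :: "nat \<Rightarrow> real" and p :: nat
  assumes basis: "eigenbasis v s p"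
begin

lemma p_le: "p \<le> m"
  and s_pos: "i < p \<Longrightarrow> 0 < s (Suc i)"
  and s_pos': "i \<in> {1..p} \<Longrightarrow> 0 < s i"
  and v_orth: "i < m \<Longrightarrow> j < m \<Longrightarrow> dot m (v i) (v j) = (if i = j then 1 else 0)"
  and v_eigen: "i < m \<Longrightarrow> t < m \<Longrightarrow> matvec m gram (v i) t = (if i < p then s (Suc i) else 0) * v i t"
  using basis by (simp_all add: eigenbasis_def)

text \<open>The factor normalises, since \<open>synthesis (v i)\<close> has squared norm
  \<open>s (Suc i)\<close> for \<open>i < p\<close>. The \<open>Suc\<close> bridges eigenvectors
  counted from 0 and eigenvalues counted from 1.\<close>

definition efun :: "nat \<Rightarrow> 'a \<Rightarrow> real" where
  "efun i = (\<lambda>x. 1 / sqrt (s (Suc i)) * synthesis (v i) x)"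

lemma efun_L2: "efun i \<in> L2 L"
  unfolding efun_def by (intro L2_cmult synthesis_L2)

lemma ip_synthesis_v:
  assumes "i < m" "j < m"
  shows "ip L (synthesis (v i)) (synthesis (v j)) = (if i = j \<and> i < p then s (Suc i) else 0)"
proof -
  have "ip L (synthesis (v i)) (synthesis (v j)) =
      dot m (v i) (\<lambda>t. (if j < p then s (Suc j) else 0) * v j t)"
    unfolding ip_synthesis_synthesis by (rule dot_cong) (simp_all add: v_eigen assms)
  also have "\<dots> = (if j < p then s (Suc j) else 0) * dot m (v i) (v j)"
    by (rule dot_linear)
  also have "\<dots> = (if i = j \<and> i < p then s (Suc i) else 0)"
    using v_orth[OF assms] by simp
  finally show ?thesis .
qed

lemma efun_orth:
  assumes "i < p" "j < p"
  shows "ip L (efun i) (efun j) = (if i = j then 1 else 0)"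
proof -
  have "ip L (efun i) (efun j) = 1 / sqrt (s (Suc i)) * (1 / sqrt (s (Suc j)) *
      (if i = j \<and> i < p then s (Suc i) else 0))"
    using assms p_le by (simp only: efun_def ip_cmult) (simp add: ip_synthesis_v)
  then show ?thesis using s_pos[OF assms(1)] assms(1) by (cases "i = j") simp_all
qed

text \<open>The squared norm is the Gram form at \<open>v i\<close>, and the eigenvalue is 0 from
  index \<open>p\<close> on.\<close>

lemma synthesis_v_null:
  assumes "p \<le> i" "i < m"
  shows "AE x in L. synthesis (v i) x = 0"
  using assms by (intro ip_self_eq_0 synthesis_L2) (simp add: ip_synthesis_v)

text \<open>\<open>gram\<close> contributes the factor \<open>s (Suc i)\<close> and the
  normalisation its inverse square root.\<close>

lemma analysis_efun:
  assumes "i < p" "t < m"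
  shows "analysis (efun i) t = sqrt (s (Suc i)) * v i t"
proof -
  have "analysis (efun i) t = 1 / sqrt (s (Suc i)) * analysis (synthesis (v i)) t"
    by (simp add: analysis_def efun_def ip_cmult del: times_divide_eq_left)
  also have "\<dots> = 1 / sqrt (s (Suc i)) * (s (Suc i) * v i t)"
    using assms p_le by (simp add: analysis_synthesis v_eigen)
  also have "\<dots> = sqrt (s (Suc i)) * v i t"
    using s_pos[OF assms(1)] by (simp add: field_simps)
  finally show ?thesis .
qed

lemma frame_op_efun:
  assumes "i < p"
  shows "frame_op (efun i) = (\<lambda>x. s (Suc i) * efun i x)"
proof -
  have "frame_op (efun i) = synthesis (\<lambda>t. sqrt (s (Suc i)) * v i t)"
    unfolding frame_op_def by (rule synthesis_cong) (rule analysis_efun[OF assms])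
  also have "\<dots> = (\<lambda>x. s (Suc i) / sqrt (s (Suc i)) * synthesis (v i) x)"
    using s_pos[OF assms] by (simp only: synthesis_cmult real_div_sqrt less_imp_le)
  finally show ?thesis by (simp add: efun_def)
qed

lemma ip_frame_op_efun:
  assumes "u \<in> L2 L" "i < p"
  shows "ip L (frame_op u) (efun i) = s (Suc i) * ip L u (efun i)"
proof -
  have "ip L (frame_op u) (efun i) = ip L u (frame_op (efun i))"
    using assms by (simp add: ip_frame_op efun_L2)
  also have "\<dots> = s (Suc i) * ip L u (efun i)"
    by (simp add: frame_op_efun assms ip_cmult)
  finally show ?thesis .
qed

lemma efun_eigenspace:
  assumes "i < p"
  shows "efun i \<in> L2_eigenspace L frame_op (s (Suc i))"
  using assms by (simp add: L2_eigenspace_def efun_L2 frame_op_efun)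

text \<open>Expanding \<open>a\<close> in the basis \<open>v\<close> and dropping the null functions
  from \<open>p\<close> on leaves multiples of \<open>efun i\<close>; the square roots from
  \<open>analysis_efun\<close> and from the normalisation cancel. So the \<open>efun i\<close> with
  \<open>i < p\<close> are an orthonormal basis of the range of \<open>synthesis\<close>.\<close>

lemma synthesis_expansion: "AE x in L. synthesis a x = (\<Sum>i<p. ip L (synthesis a) (efun i) * efun i x)"
proof -
  have "synthesis a = synthesis (\<lambda>t. \<Sum>i<m. dot m a (v i) * v i t)"
    by (rule synthesis_cong, rule orthonormal_expansion) (simp_all add: v_orth)
  also have "\<dots> = (\<lambda>x. \<Sum>i<m. dot m a (v i) * synthesis (v i) x)"
    by (rule synthesis_sum)
  finally have exp: "synthesis a = \<dots>" .
  have "AE x in L. \<forall>i\<in>{p..<m}. synthesis (v i) x = 0"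
    using synthesis_v_null by (subst AE_finite_all) auto
  then have trunc: "AE x in L. (\<Sum>i<m. dot m a (v i) * synthesis (v i) x) = (\<Sum>i<p. dot m a (v i) * synthesis (v i) x)"
  proof eventually_elim
    case (elim x)
    then show ?case using p_le by (intro sum.mono_neutral_right) auto
  qed
  have "dot m a (v i) * synthesis (v i) x = ip L (synthesis a) (efun i) * efun i x" if "i < p" for i x
  proof -
    have "ip L (synthesis a) (efun i) = dot m a (\<lambda>t. sqrt (s (Suc i)) * v i t)"
      unfolding ip_synthesis_left[OF efun_L2]
      by (rule dot_cong) (simp_all add: analysis_efun that)
    then have "ip L (synthesis a) (efun i) = sqrt (s (Suc i)) * dot m a (v i)"
      by (simp only: dot_linear)
    then show ?thesis using s_pos[OF that] by (simp add: efun_def)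
  qed
  then have "(\<Sum>i<p. dot m a (v i) * synthesis (v i) x) = (\<Sum>i<p. ip L (synthesis a) (efun i) * efun i x)" for x
    by (intro sum.cong) auto
  with trunc show ?thesis by (simp add: fun_cong[OF exp])
qed

text \<open>For \<open>l \<noteq> 0\<close> an eigenfunction equals \<open>frame_op f\<close>
  divided by \<open>l\<close>, so it lies in the range of \<open>synthesis\<close>. Self-adjointness
  kills its coefficients along eigenfunctions of other eigenvalues.\<close>

lemma eigenspace_expansion:
  assumes f: "f \<in> L2_eigenspace L frame_op l" and l: "l \<noteq> 0"
  shows "AE x in L. f x = (\<Sum>i<p. ip L f (efun i) * efun i x)"
    and "i < p \<Longrightarrow> s (Suc i) \<noteq> l \<Longrightarrow> ip L f (efun i) = 0"
proof -
  have fL: "f \<in> L2 L" and fe: "AE x in L. frame_op f x = l * f x"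
    using f by (auto simp: L2_eigenspace_def)
  let ?a = "\<lambda>t. (1 / l) * analysis f t"
  have "AE x in L. f x = synthesis ?a x"
    using fe unfolding synthesis_cmult frame_op_def[symmetric]
    by eventually_elim (use l in simp)
  then have eq: "ip L f (efun i) = ip L (synthesis ?a) (efun i)" for i
    by (rule ip_cong_AE) (simp_all only: fL synthesis_L2 efun_L2)
  show "AE x in L. f x = (\<Sum>i<p. ip L f (efun i) * efun i x)"
    using \<open>AE x in L. f x = synthesis ?a x\<close> synthesis_expansion[of ?a]
    unfolding eq by eventually_elim simp
  assume i: "i < p" "s (Suc i) \<noteq> l"
  have "ip L (frame_op f) (efun i) = ip L (\<lambda>x. l * f x) (efun i)"
    using fe by (rule ip_cong_AE) (intro frame_op_L2 L2_cmult fL efun_L2)+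
  then have "s (Suc i) * ip L f (efun i) = l * ip L f (efun i)"
    by (simp only: ip_frame_op_efun[OF fL i(1)] ip_cmult)
  then show "ip L f (efun i) = 0" using i(2) by simp
qed

lemma ip_efun_sum:
  assumes "I \<subseteq> {..<p}" "j \<in> I"
  shows "ip L (\<lambda>x. \<Sum>i\<in>I. c i * efun i x) (efun j) = c j"
proof -
  have fin: "finite I" using assms(1) by (rule finite_subset) simp
  have "ip L (\<lambda>x. \<Sum>i\<in>I. c i * efun i x) (efun j) = (\<Sum>i\<in>I. c i * ip L (efun i) (efun j))"
    by (simp add: ip_sum efun_L2)
  also have "\<dots> = (\<Sum>i\<in>I. if i = j then c i else 0)"
    using assms by (intro sum.cong) (auto simp: efun_orth subset_eq)
  also have "\<dots> = c j" using assms(2) fin by simp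
  finally show ?thesis .
qed

lemma L2_dim_eigenspace:
  assumes l: "l \<noteq> 0"
  shows "L2_dim L (L2_eigenspace L frame_op l) = card {i\<in>{1..p}. s i = l}"
proof -
  define I where "I = {i. i < p \<and> s (Suc i) = l}"
  have I: "finite I" "I \<subseteq> {..<p}" by (auto simp: I_def)
  have "{i\<in>{1..p}. s i = l} = Suc ` I"
  proof (rule Set.set_eqI)
    fix i show "i \<in> {i\<in>{1..p}. s i = l} \<longleftrightarrow> i \<in> Suc ` I"
      by (cases i) (auto simp: I_def image_iff)
  qed
  then have card: "card {i\<in>{1..p}. s i = l} = card I" by (simp add: card_image)
  \<comment> \<open>\<open>L2_has_dim\<close> wants a family on an initial segment, so
    \<open>I\<close> is enumerated by \<open>h\<close>.\<close>
  obtain h where h: "bij_betw h {..<card I} I"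
    using ex_bij_betw_nat_finite[OF I(1)] by (auto simp: atLeast0LessThan)
  have reindex: "(\<Sum>i<card I. c (h i) * efun (h i) x) = (\<Sum>i\<in>I. c i * efun i x)" for c x
    using sum.reindex_bij_betw[OF h, of "\<lambda>i. c i * efun i x"] .
  have hI: "h i \<in> I" if "i < card I" for i using h that by (auto simp: bij_betw_def)
  have "L2_has_dim L (L2_eigenspace L frame_op l) (card I)"
    unfolding L2_has_dim_def
  proof (intro exI[of _ "\<lambda>i. efun (h i)"] conjI allI impI ballI)
    fix i assume "i < card I"
    then show "efun (h i) \<in> L2_eigenspace L frame_op l"
      using hI efun_eigenspace[of "h i"] by (simp add: I_def)
  next
    fix c i assume z: "AE x in L. (\<Sum>i<card I. c i * efun (h i) x) = 0" and i: "i < card I"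
    \<comment> \<open>The coefficients are carried along \<open>h\<close> to \<open>I\<close>, where
      \<open>ip_efun_sum\<close> reads them off.\<close>
    define d where "d = (\<lambda>k. c (the_inv_into {..<card I} h k))"
    have d: "d (h i) = c i" if "i < card I" for i
      using h that by (simp add: d_def bij_betw_def the_inv_into_f_f)
    have "(\<Sum>i<card I. c i * efun (h i) x) = (\<Sum>i\<in>I. d i * efun i x)" for x
      unfolding reindex[symmetric] using d by simp
    with z have "AE x in L. (\<Sum>i\<in>I. d i * efun i x) = 0" by simp
    then have "ip L (\<lambda>x. \<Sum>i\<in>I. d i * efun i x) (efun (h i)) = ip L (\<lambda>x. 0) (efun (h i))"
      by (rule ip_cong_AE) (intro L2_sum efun_L2 | simp add: L2_real_iff)+
    then have "d (h i) = 0" using ip_efun_sum[OF I(2) hI[OF i]] by (simp add: ip_def)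
    then show "c i = 0" using d[OF i] by simp
  next
    fix f assume f: "f \<in> L2_eigenspace L frame_op l"
    have "(\<Sum>i<p. ip L f (efun i) * efun i x) = (\<Sum>i\<in>I. ip L f (efun i) * efun i x)" for x
      using eigenspace_expansion(2)[OF f l] I by (intro sum.mono_neutral_right) (auto simp: I_def)
    then have "AE x in L. f x = (\<Sum>i<card I. ip L f (efun (h i)) * efun (h i) x)"
      using eigenspace_expansion(1)[OF f l] by (simp add: reindex[of "\<lambda>i. ip L f (efun i)"])
    then show "\<exists>c. AE x in L. f x = (\<Sum>i<card I. c i * efun (h i) x)" by (intro exI)
  qed
  then show ?thesis unfolding card by (rule L2_dim_eqI)
qed

text \<open>Orthogonality of the error makes \<open>c i\<close> the coefficient of \<open>u\<close>
  along \<open>efun i\<close>. Testing the normal equation against \<open>efun i\<close> shows that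
  \<open>s (Suc i)\<close> times this coefficient is
  \<open>sqrt (s (Suc i)) * dot m (v i) b\<close>; together with the normalisation of
  \<open>efun i\<close> this leaves the factor \<open>inverse (s (Suc i))\<close>.\<close>

lemma projected_solution_eq:
  assumes r: "r \<le> p"
    and u: "u \<in> L2 L" "AE x in L. frame_op u x = synthesis b x"
    and ur: "ur \<in> L2 L" "AE x in L. ur x = (\<Sum>i<r. c i * efun i x)"
    and orth: "\<And>i. i < r \<Longrightarrow> ip L (\<lambda>x. u x - ur x) (efun i) = 0"
  shows "AE x in L. ur x = synthesis (\<lambda>t. \<Sum>i<r. inverse (s (Suc i)) * dot m (v i) b * v i t) x"
proof -
  have "c i * efun i x = inverse (s (Suc i)) * dot m (v i) b * synthesis (v i) x" if "i < r" for i x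
  proof -
    have i: "i < p" using that r by simp
    have pos: "s (Suc i) > 0" using s_pos[OF i] .
    have "ip L ur (efun i) = ip L (\<lambda>x. \<Sum>i<r. c i * efun i x) (efun i)"
      using ur(2) by (rule ip_cong_AE) (intro ur(1) L2_sum efun_L2)+
    also have "\<dots> = c i" using that r by (intro ip_efun_sum) auto
    finally have c: "c i = ip L u (efun i)"
      using orth[OF that] by (simp add: ip_diff u(1) ur(1) efun_L2)
    have "s (Suc i) * ip L u (efun i) = ip L (frame_op u) (efun i)"
      by (simp add: ip_frame_op_efun u(1) i)
    also have "\<dots> = ip L (synthesis b) (efun i)"
      using u(2) by (rule ip_cong_AE) (intro frame_op_L2 synthesis_L2 efun_L2)+
    also have "\<dots> = dot m b (\<lambda>t. sqrt (s (Suc i)) * v i t)"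
      unfolding ip_synthesis_left[OF efun_L2] by (rule dot_cong) (simp_all add: analysis_efun i)
    also have "\<dots> = sqrt (s (Suc i)) * dot m (v i) b"
      by (simp only: dot_linear dot_commute[of m b])
    finally have "ip L u (efun i) = inverse (s (Suc i)) * sqrt (s (Suc i)) * dot m (v i) b"
      using pos by (simp add: field_simps)
    then show ?thesis using pos by (simp add: c efun_def)
  qed
  then have "(\<Sum>i<r. c i * efun i x) = synthesis (\<lambda>t. \<Sum>i<r. inverse (s (Suc i)) * dot m (v i) b * v i t) x" for x
    unfolding synthesis_sum[of "\<lambda>i. inverse (s (Suc i)) * dot m (v i) b"] by simp
  then show ?thesis using ur(2) by simp
qed

end

section \<open>Matching the eigenvalues and the truncated solutions\<close>

text \<open>Removing the common first \<open>r\<close> values leaves two decreasing lists with the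
  same multiset of values, hence equal lists. Order is assumed only beyond \<open>r\<close>, to
  cover both fully sorted lists, at \<open>r = 0\<close>, and lists whose first \<open>r\<close>
  entries are prescribed.\<close>

lemma decreasing_eq_of_card_eq:
  fixes a c :: "nat \<Rightarrow> real"
  assumes dec: "\<And>i j. r < i \<Longrightarrow> i \<le> j \<Longrightarrow> j \<le> k \<Longrightarrow> a j \<le> a i"
      "\<And>i j. r < i \<Longrightarrow> i \<le> j \<Longrightarrow> j \<le> p \<Longrightarrow> c j \<le> c i"
    and r: "r \<le> k" "r \<le> p" "\<And>i. i \<in> {1..r} \<Longrightarrow> a i = c i"
    and card: "\<And>l. card {i\<in>{1..k}. a i = l} = card {i\<in>{1..p}. c i = l}"
  shows "k = p" and "\<And>i. i \<in> {1..k} \<Longrightarrow> a i = c i"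
proof -
  let ?tail = "\<lambda>f n. map f [Suc r..<Suc n]"
  have count: "count (mset (?tail f n)) l = card {i\<in>{1..n}. f i = l} - card {i\<in>{1..r}. f i = l}"
    if "r \<le> n" for f :: "nat \<Rightarrow> real" and n l
  proof -
    have "count (mset (?tail f n)) l = card {i\<in>{Suc r..n}. f i = l}"
      by (simp only: mset_map mset_upt atLeastLessThanSuc_atLeastAtMost
          count_image_mset_eq_card_vimage[OF finite_atLeastAtMost])
    also have "{i\<in>{Suc r..n}. f i = l} = {i\<in>{1..n}. f i = l} - {i\<in>{1..r}. f i = l}"
      using that by auto
    also have "card \<dots> = card {i\<in>{1..n}. f i = l} - card {i\<in>{1..r}. f i = l}"
      using that by (intro card_Diff_subset) auto
    finally show ?thesis .
  qed
  have "{i\<in>{1..r}. a i = l} = {i\<in>{1..r}. c i = l}" for l using r(3) by auto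
  then have "mset (?tail a k) = mset (?tail c p)"
    using r by (intro multiset_eqI) (simp only: count card)
  then have mset: "mset (rev (?tail c p)) = mset (rev (?tail a k))" by (simp only: mset_rev)
  \<comment> \<open>Reversed, because \<open>sorted\<close> means increasing.\<close>
  have sorted: "sorted (rev (?tail f n))"
    if "\<And>i j. r < i \<Longrightarrow> i \<le> j \<Longrightarrow> j \<le> n \<Longrightarrow> f j \<le> f i" for f :: "nat \<Rightarrow> real" and n
    unfolding sorted_rev_iff_nth_mono using that by (auto simp del: upt_Suc)
  have "sort (rev (?tail a k)) = rev (?tail c p)"
    using mset by (rule properties_for_sort) (intro sorted dec(2))
  moreover have "sort (rev (?tail a k)) = rev (?tail a k)"
    by (intro sorted_sort_id sorted dec(1))
  ultimately have "rev (?tail a k) = rev (?tail c p)" by (simp only:)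
  then have eq: "?tail a k = ?tail c p" by (simp only: rev_is_rev_conv)
  then have "length (?tail a k) = length (?tail c p)" by (simp only:)
  then show "k = p" using r by (simp del: upt_Suc)
  fix i assume i: "i \<in> {1..k}"
  show "a i = c i"
  proof (cases "i \<le> r")
    case True
    then show ?thesis using i r(3) by simp
  next
    case False
    then have "?tail a k ! (i - Suc r) = ?tail c p ! (i - Suc r)" using eq by simp
    then show ?thesis using False i \<open>k = p\<close> by (simp del: upt_Suc)
  qed
qed

lemma L2_span_superset: "h \<in> S \<Longrightarrow> h \<in> L2 L \<Longrightarrow> h \<in> L2_span L S"
  unfolding L2_span_def
  by (intro CollectI conjI exI[of _ 1] exI[of _ "\<lambda>_. h"] exI[of _ "\<lambda>_. 1"]) auto

lemma L2_span_AE_combination: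
  assumes f: "f \<in> L2_span L S"
    and S: "\<And>h. h \<in> S \<Longrightarrow> \<exists>d. AE x in L. h x = (\<Sum>j<r. d j * e j x)"
  obtains c where "AE x in L. f x = (\<Sum>j<(r::nat). c j * e j x)"
proof -
  obtain n :: nat and h c where h: "\<forall>i<n. h i \<in> S" "AE x in L. f x = (\<Sum>i<n. c i * h i x)"
    using f unfolding L2_span_def by auto
  have "\<forall>i\<in>{..<n}. \<exists>d. AE x in L. h i x = (\<Sum>j<r. d j * e j x)" using h(1) S by simp
  from bchoice[OF this] obtain d where d: "\<And>i. i \<in> {..<n} \<Longrightarrow> AE x in L. h i x = (\<Sum>j<r. d i j * e j x)"
    by blast
  have "AE x in L. (\<Sum>i<n. c i * h i x) = (\<Sum>i<n. c i * (\<Sum>j<r. d i j * e j x))"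
    by (rule AE_sum_cong) (use d in auto)
  moreover have "(\<Sum>i<n. c i * (\<Sum>j<r. d i j * e j x)) = (\<Sum>j<r. (\<Sum>i<n. c i * d i j) * e j x)" for x
    unfolding sum_distrib_left sum_distrib_right by (subst sum.swap) (simp add: mult.assoc)
  ultimately have "AE x in L. (\<Sum>i<n. c i * h i x) = (\<Sum>j<r. (\<Sum>i<n. c i * d i j) * e j x)"
    by (simp only:)
  with h(2) have "AE x in L. f x = (\<Sum>j<r. (\<Sum>i<n. c i * d i j) * e j x)"
    by eventually_elim simp
  then show ?thesis by (rule that)
qed

context l2_frame_eigenbasis
begin

text \<open>For \<open>l \<noteq> 0\<close> both lists count the dimension of the same eigenspace,
  one by hypothesis and the other by \<open>L2_dim_eigenspace\<close>, so all multiplicities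
  agree.\<close>

lemma nonzero_eigenvalues_eq:
  assumes lam: "nonzero_eigenvalues L frame_op k lam"
    and r: "r \<le> k" "r \<le> p" "\<And>i. i \<in> {1..r} \<Longrightarrow> lam i = s i"
    and dec: "\<And>i j. r < i \<Longrightarrow> i \<le> j \<Longrightarrow> j \<le> p \<Longrightarrow> s j \<le> s i"
  shows "k = p" and "\<And>i. i \<in> {1..p} \<Longrightarrow> lam i = s i"
proof -
  have pos: "\<And>i. i \<in> {1..k} \<Longrightarrow> lam i > 0" and decl: "\<And>i j. i \<in> {1..k} \<Longrightarrow> j \<in> {1..k} \<Longrightarrow> i \<le> j \<Longrightarrow> lam j \<le> lam i"
    and dim: "\<And>l. l \<noteq> 0 \<Longrightarrow> L2_dim L (L2_eigenspace L frame_op l) = card {i\<in>{1..k}. lam i = l}"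
    using lam unfolding nonzero_eigenvalues_def by blast+
  \<comment> \<open>\<open>nonzero_eigenvalues\<close> is silent at \<open>l = 0\<close>; there both
    index sets are empty by positivity.\<close>
  have card: "card {i\<in>{1..k}. lam i = l} = card {i\<in>{1..p}. s i = l}" for l
  proof (cases "l = 0")
    case True
    have "lam i \<noteq> 0" if "i \<in> {1..k}" for i using pos[OF that] by simp
    moreover have "s i \<noteq> 0" if "i \<in> {1..p}" for i
      using s_pos'[OF that] by simp
    ultimately have "{i\<in>{1..k}. lam i = 0} = {}" "{i\<in>{1..p}. s i = 0} = {}" by blast+
    then show ?thesis using True by (simp only:)
  next
    case False
    then show ?thesis using dim L2_dim_eigenspace by simp
  qed
  have decl': "lam j \<le> lam i" if "r < i" "i \<le> j" "j \<le> k" for i j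
    using that by (intro decl) auto
  show "k = p" "\<And>i. i \<in> {1..p} \<Longrightarrow> lam i = s i"
    using decreasing_eq_of_card_eq[OF decl' dec r card] by simp_all
qed

lemma leading_eigensystem_efun:
  assumes "r \<le> p" "\<And>i. i \<in> {1..p} \<Longrightarrow> lam i = s i"
  shows "leading_eigensystem L frame_op lam r (\<lambda>i. efun (i - 1))"
  unfolding leading_eigensystem_def
proof (intro conjI ballI)
  fix i assume "i \<in> {1..r}"
  then have i: "i \<in> {1..p}" "i - 1 < p" "Suc (i - 1) = i" using assms(1) by auto
  show "efun (i - 1) \<in> L2_eigenspace L frame_op (lam i)"
    using efun_eigenspace[OF i(2)] assms(2)[OF i(1)] i(3) by simp
next
  fix i j assume "i \<in> {1..r}" "j \<in> {1..r}"
  then show "(LINT x|L. efun (i - 1) x * efun (j - 1) x) = (if i = j then 1 else 0)"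
    using assms(1) efun_orth[of "i - 1" "j - 1"] by (auto simp: ip_def)
qed

text \<open>Serves both truncation spaces, the span of whole eigenspaces and that of chosen
  eigenfunctions: the two hypotheses on \<open>S\<close> say that, modulo null functions, its span
  is that of the first \<open>r\<close> functions \<open>efun\<close>.\<close>

lemma projected_solution_span:
  assumes r: "r \<le> p"
    and S: "\<And>h. h \<in> S \<Longrightarrow> \<exists>d. AE x in L. h x = (\<Sum>j<r. d j * efun j x)"
    and e: "\<And>i. i < r \<Longrightarrow> \<exists>h\<in>S. h \<in> L2 L \<and> (AE x in L. h x = efun i x)"
    and ur: "projected_solution L frame_op (synthesis b) (L2_span L S) ur"
  shows "AE x in L. ur x = synthesis (\<lambda>t. \<Sum>i<r. inverse (s (Suc i)) * dot m (v i) b * v i t) x"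
proof -
  obtain u where u: "u \<in> L2 L" "AE x in L. frame_op u x = synthesis b x"
    and urS: "ur \<in> L2_span L S" and orth: "(\<lambda>x. u x - ur x) \<in> L2_orth L (L2_span L S)"
    using ur unfolding projected_solution_def L2_proj_def by blast
  have urL: "ur \<in> L2 L" using urS by (simp add: L2_span_def)
  obtain c where c: "AE x in L. ur x = (\<Sum>j<r. c j * efun j x)"
    using urS S by (rule L2_span_AE_combination)
  have "ip L (\<lambda>x. u x - ur x) (efun i) = 0" if i: "i < r" for i
  proof -
    obtain h where h: "h \<in> S" "h \<in> L2 L" "AE x in L. h x = efun i x" using e[OF i] by blast
    have "ip L (efun i) (\<lambda>x. u x - ur x) = ip L h (\<lambda>x. u x - ur x)"
      using h(3) by (intro ip_cong_AE[symmetric] efun_L2 h L2_diff u urL)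
    moreover have "ip L (\<lambda>x. u x - ur x) h = 0"
      using orth L2_span_superset[OF h(1,2)] by (simp add: L2_orth_def ip_def)
    ultimately show ?thesis by (simp add: ip_commute)
  qed
  then show ?thesis by (rule projected_solution_eq[OF r u urL c])
qed

lemma projected_solution_eigensystem:
  assumes r: "r \<le> p"
    and e: "\<And>i. i < r \<Longrightarrow> e (Suc i) \<in> L2 L" "\<And>i. i < r \<Longrightarrow> AE x in L. e (Suc i) x = efun i x"
    and ur: "projected_solution L frame_op (synthesis b) (L2_span L (e ` {1..r})) ur"
  shows "AE x in L. ur x = synthesis (\<lambda>t. \<Sum>i<r. inverse (s (Suc i)) * dot m (v i) b * v i t) x"
  using r _ _ ur
proof (rule projected_solution_span)
  fix h assume "h \<in> e ` {1..r}"
  then obtain i where i: "h = e i" "i \<in> {1..r}" by blast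
  then have "i - 1 < r" and i1: "Suc (i - 1) = i" by auto
  have "(\<Sum>j<r. (if j = i - 1 then 1 else 0) * efun j x) = efun (i - 1) x" for x
    using \<open>i - 1 < r\<close> by (simp add: if_distrib[of "\<lambda>c. c * _"] cong: if_cong)
  then have "AE x in L. h x = (\<Sum>j<r. (if j = i - 1 then 1 else 0) * efun j x)"
    using e(2)[OF \<open>i - 1 < r\<close>] unfolding i(1) i1 by (simp only:)
  then show "\<exists>d. AE x in L. h x = (\<Sum>j<r. d j * efun j x)" by (intro exI)
next
  fix i assume "i < r"
  then show "\<exists>h\<in>e ` {1..r}. h \<in> L2 L \<and> (AE x in L. h x = efun i x)"
    using e by (intro bexI[of _ "e (Suc i)"]) auto
qed

text \<open>The gap keeps \<open>efun j\<close> with \<open>j \<ge> r\<close> out of the eigenspaces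
  of the first \<open>r\<close> eigenvalues, so these eigenspaces lie in the span of the first
  \<open>r\<close> functions \<open>efun\<close>.\<close>

lemma projected_solution_eigenspan:
  assumes r: "r \<le> p" and lam: "\<And>i. i \<in> {1..r} \<Longrightarrow> lam i = s i"
    and gap: "\<And>i j. i \<in> {1..r} \<Longrightarrow> r < j \<Longrightarrow> j \<le> p \<Longrightarrow> s j \<noteq> s i"
    and ur: "projected_solution L frame_op (synthesis b) (leading_eigenspan L frame_op lam r) ur"
  shows "AE x in L. ur x = synthesis (\<lambda>t. \<Sum>i<r. inverse (s (Suc i)) * dot m (v i) b * v i t) x"
  using r _ _ ur[unfolded leading_eigenspan_def]
proof (rule projected_solution_span)
  fix h assume "h \<in> (\<Union>i\<in>{1..r}. L2_eigenspace L frame_op (lam i))"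
  then obtain i where i: "i \<in> {1..r}" "h \<in> L2_eigenspace L frame_op (s i)" using lam by auto
  have "s i \<noteq> 0" using i(1) r s_pos'[of i] by auto
  note exp = eigenspace_expansion[OF i(2) this]
  have "ip L h (efun j) = 0" if "r \<le> j" "j < p" for j
    using exp(2)[OF that(2)] gap[OF i(1), of "Suc j"] that by simp
  then have "(\<Sum>j<p. ip L h (efun j) * efun j x) = (\<Sum>j<r. ip L h (efun j) * efun j x)" for x
    using r by (intro sum.mono_neutral_right) auto
  then have "AE x in L. h x = (\<Sum>j<r. ip L h (efun j) * efun j x)"
    using exp(1) by (simp only:)
  then show "\<exists>d. AE x in L. h x = (\<Sum>j<r. d j * efun j x)" by (intro exI)
next
  fix i assume "i < r"
  then have "efun i \<in> L2_eigenspace L frame_op (lam (Suc i))"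
    using lam[of "Suc i"] r efun_eigenspace[of i] by simp
  then show "\<exists>h\<in>(\<Union>i\<in>{1..r}. L2_eigenspace L frame_op (lam i)). h \<in> L2 L \<and> (AE x in L. h x = efun i x)"
    using \<open>i < r\<close> by (intro bexI[of _ "efun i"]) (auto simp: efun_L2)
qed

end

section \<open>From eigenfunctions of \<open>frame_op\<close> to an eigenbasis of
  \<open>gram\<close>\<close>

lemma orthonormal_le_dim:
  fixes r m :: nat
  assumes orth: "\<And>i j. i < r \<Longrightarrow> j < r \<Longrightarrow> dot m (v i) (v j) = (if i = j then 1 else 0)"
  shows "r \<le> m"
proof (rule ccontr)
  assume "\<not> r \<le> m"
  then have "m < r" by simp
  then obtain c where c: "\<exists>i<r. c i \<noteq> 0" "\<And>t. t < m \<Longrightarrow> (\<Sum>i<r. c i * v i t) = 0"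
    using homogeneous_system_nontrivial[of m r v] by metis
  have "c j = 0" if "j < r" for j
  proof -
    have "c j = dot m (\<lambda>t. \<Sum>i<r. c i * v i t) (v j)"
      using dot_orthonormal_sum[OF orth that, of c] by simp
    also have "\<dots> = 0" using c(2) by (simp add: dot_def)
    finally show ?thesis .
  qed
  with c(1) show False by blast
qed

text \<open>Applying \<open>analysis\<close> and dividing by the root of the eigenvalue turns the
  eigenfunctions into orthonormal eigenvectors of \<open>gram\<close>, which
  \<open>extend_eigenvectors\<close> completes. Equality of multiplicities then shows that exactly
  \<open>k\<close> eigenvalues are positive.\<close>

lemma (in l2_frame) exists_eigenbasis_extending:
  assumes lam: "nonzero_eigenvalues L frame_op k lam" and r: "r \<le> k"
    and e: "leading_eigensystem L frame_op lam r e"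
  obtains v s where "eigenbasis v s k" "\<And>i. i \<in> {1..k} \<Longrightarrow> s i = lam i"
    "\<And>i. i < r \<Longrightarrow> AE x in L. e (Suc i) x = l2_frame_eigenbasis.efun m g v s i x"
proof -
  define l where "l = (\<lambda>i. lam (Suc i))"
  have lpos: "l i > 0" if "i < r" for i using lam r that by (auto simp: nonzero_eigenvalues_def l_def)
  have eL: "e (Suc i) \<in> L2 L" and eeig: "AE x in L. frame_op (e (Suc i)) x = l i * e (Suc i) x" if "i < r" for i
    using e that by (auto simp: leading_eigensystem_def L2_eigenspace_def l_def)
  have eorth: "ip L (e (Suc i)) (e (Suc j)) = (if i = j then 1 else 0)" if "i < r" "j < r" for i j
    using e that by (auto simp: leading_eigensystem_def ip_def)
  define v0 where "v0 = (\<lambda>i t. 1 / sqrt (l i) * analysis (e (Suc i)) t)"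
  have orth0: "dot m (v0 i) (v0 j) = (if i = j then 1 else 0)" if "i < r" "j < r" for i j
  proof -
    have "dot m (analysis (e (Suc i))) (analysis (e (Suc j))) = ip L (frame_op (e (Suc i))) (e (Suc j))"
      using that by (simp add: ip_frame_op eL)
    also have "\<dots> = ip L (\<lambda>x. l i * e (Suc i) x) (e (Suc j))"
      using eeig[OF that(1)] by (rule ip_cong_AE) (intro frame_op_L2 L2_cmult eL that)+
    also have "\<dots> = l i * (if i = j then 1 else 0)"
      using eorth[OF that] by (simp only: ip_cmult)
    finally have "dot m (v0 i) (v0 j) = 1 / sqrt (l i) * (1 / sqrt (l j) * (l i * (if i = j then 1 else 0)))"
      by (simp only: v0_def dot_linear)
    then show ?thesis using lpos[OF that(1)] by (cases "i = j") simp_all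
  qed
  have eig0: "matvec m gram (v0 i) t = l i * v0 i t" if "i < r" "t < m" for i t
  proof -
    have "analysis (frame_op (e (Suc i))) t = analysis (\<lambda>x. l i * e (Suc i) x) t"
      using eeig[OF that(1)] by (rule analysis_cong_AE) (intro frame_op_L2 L2_cmult eL that)+
    then have "matvec m gram (analysis (e (Suc i))) t = l i * analysis (e (Suc i)) t"
      using that(2) by (simp add: frame_op_def analysis_synthesis) (simp add: analysis_def ip_cmult)
    then show ?thesis by (simp only: v0_def matvec_linear) simp
  qed
  have "r \<le> m" using orth0 by (rule orthonormal_le_dim)
  obtain v c where v: "\<And>i. i < r \<Longrightarrow> v i = v0 i" "\<And>i. i < r \<Longrightarrow> c i = l i"
    "\<And>i j. i < m \<Longrightarrow> j < m \<Longrightarrow> dot m (v i) (v j) = (if i = j then 1 else 0)"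
    "\<And>i t. i < m \<Longrightarrow> t < m \<Longrightarrow> matvec m gram (v i) t = c i * v i t"
    "\<And>i j. r \<le> i \<Longrightarrow> i \<le> j \<Longrightarrow> j < m \<Longrightarrow> c j \<le> c i"
    using extend_eigenvectors[of m gram r v0 l] gram_sym orth0 eig0 \<open>r \<le> m\<close> by blast
  have c_nonneg: "0 \<le> c i" if "i < m" for i
  proof -
    have "dot m (v i) (matvec m gram (v i)) = dot m (v i) (\<lambda>t. c i * v i t)"
      by (rule dot_cong) (simp_all add: v(4) that)
    also have "\<dots> = c i" using v(3)[OF that that] by (simp add: dot_linear)
    finally show ?thesis using dot_gram_nonneg[of "v i"] by simp
  qed
  \<comment> \<open>The length of the initial run of positive eigenvalues. It is at least
    \<open>r\<close>, and \<open>c\<close> decreases from \<open>r\<close> on, so all later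
    eigenvalues are at most 0, hence 0 by nonnegativity.\<close>
  define p where "p = (LEAST n. n = m \<or> c n \<le> 0)"
  have p: "p = m \<or> c p \<le> 0" unfolding p_def by (rule LeastI[of _ m]) simp
  have pm: "p \<le> m" unfolding p_def by (rule Least_le) simp
  have p_pos: "0 < c i" if "i < p" for i
    using not_less_Least[OF that[unfolded p_def]] by simp
  have rp: "r \<le> p"
  proof (rule ccontr)
    assume "\<not> r \<le> p"
    then have "p < r" by simp
    then show False using p lpos[of p] v(2)[of p] \<open>r \<le> m\<close> by auto
  qed
  have c_0: "c i = 0" if "p \<le> i" "i < m" for i
    using p v(5)[OF rp that] c_nonneg[OF that(2)] that by auto
  define s where "s = (\<lambda>i. c (i - 1))"
  have basis: "eigenbasis v s p"
    unfolding eigenbasis_def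
  proof (intro conjI ballI allI impI)
    fix i t assume "i < m" "t < m"
    then show "matvec m gram (v i) t = (if i < p then s (Suc i) else 0) * v i t"
      using v(4) c_0[of i] by (simp add: s_def)
  qed (use pm p_pos v(3) in \<open>auto simp: s_def\<close>)
  then interpret l2_frame_eigenbasis L m g v s p by unfold_locales
  have agree: "lam i = s i" if "i \<in> {1..r}" for i
  proof -
    have "i - 1 < r" "Suc (i - 1) = i" using that by auto
    then show ?thesis using v(2)[of "i - 1"] by (simp add: s_def l_def)
  qed
  have dec: "s j \<le> s i" if "r < i" "i \<le> j" "j \<le> p" for i j
    using v(5)[of "i - 1" "j - 1"] that pm by (simp add: s_def)
  \<comment> \<open>The first \<open>r\<close> eigenvalues have not been compared with the later
    ones, so they enter the matching as a prescribed part.\<close>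
  note eq = nonzero_eigenvalues_eq[OF lam r rp agree dec]
  \<comment> \<open>Going to coordinates and back divides \<open>frame_op (e (Suc i))\<close> by
    \<open>l i\<close>, which returns \<open>e (Suc i)\<close>.\<close>
  have "AE x in L. e (Suc i) x = efun i x" if "i < r" for i
    using eeig[OF that]
  proof eventually_elim
    case (elim x)
    have "efun i x = 1 / sqrt (l i) * (1 / sqrt (l i) * frame_op (e (Suc i)) x)"
    proof -
      have "s (Suc i) = l i" using v(2)[OF that] by (simp add: s_def)
      then have "efun i x = 1 / sqrt (l i) * synthesis (v0 i) x"
        by (simp only: efun_def v(1)[OF that])
      then show ?thesis by (simp only: v0_def synthesis_cmult frame_op_def)
    qed
    then show ?case using lpos[OF that] elim by simp
  qed
  then show ?thesis using that[of v s] basis eq by simp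
qed

section \<open>Singular value decompositions of the Gram matrix\<close>

lemma mult_rect_diag_mult:
  assumes A: "A \<in> carrier_mat n n" and B: "B \<in> carrier_mat n n" and p: "p \<le> n" and ij: "i < n" "j < n"
  shows "(A * rect_diag n n p a * transpose_mat B) $$ (i, j) = (\<Sum>k<p. A $$ (i, k) * a (Suc k) * B $$ (j, k))"
proof -
  have R: "rect_diag n n p a \<in> carrier_mat n n" by (simp add: rect_diag_def)
  have AR: "(A * rect_diag n n p a) $$ (i, k) = (if k < p then A $$ (i, k) * a (Suc k) else 0)" if "k < n" for k
  proof -
    have "(A * rect_diag n n p a) $$ (i, k) = (\<Sum>l<n. A $$ (i, l) * (if l = k \<and> l < p then a (Suc l) else 0))"
      using A ij that by (simp add: rect_diag_def scalar_prod_def atLeast0LessThan)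
    also have "\<dots> = (\<Sum>l<n. if l = k then (if k < p then A $$ (i, k) * a (Suc k) else 0) else 0)"
      by (intro sum.cong) auto
    finally show ?thesis using that by simp
  qed
  have "(A * rect_diag n n p a * transpose_mat B) $$ (i, j) = (\<Sum>k<n. (A * rect_diag n n p a) $$ (i, k) * B $$ (j, k))"
    using A B R ij by (simp add: scalar_prod_def atLeast0LessThan del: assoc_mult_mat)
  also have "\<dots> = (\<Sum>k<n. if k < p then A $$ (i, k) * a (Suc k) * B $$ (j, k) else 0)"
    by (intro sum.cong) (simp_all add: AR)
  also have "\<dots> = (\<Sum>k<p. A $$ (i, k) * a (Suc k) * B $$ (j, k))"
    using p by (intro sum.mono_neutral_cong_right) auto
  finally show ?thesis .
qed

text \<open>The column index comes first, so that \<open>coords V\<close> has the shape of the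
  family \<open>v\<close> in \<open>eigenbasis\<close>.\<close>

definition coords :: "real Matrix.mat \<Rightarrow> nat \<Rightarrow> nat \<Rightarrow> real" where
  "coords V i t = V $$ (t, i)"

lemma orthogonal_square_coords:
  assumes "orthogonal_square m V" "i < m" "j < m"
  shows "dot m (coords V i) (coords V j) = (if i = j then 1 else 0)"
proof -
  have V: "V \<in> carrier_mat m m" "transpose_mat V * V = 1\<^sub>m m"
    using assms(1) by (simp_all add: orthogonal_square_def)
  have "(transpose_mat V * V) $$ (i, j) = (if i = j then 1 else 0)"
    using assms V(2) by simp
  then show ?thesis using V(1) assms
    by (simp add: scalar_prod_def dot_def coords_def atLeast0LessThan)
qed

lemma truncated_pinv_nth:
  assumes V: "U \<in> carrier_mat m m" "V \<in> carrier_mat m m" and B: "B \<in> carrier_mat m m" and r: "r \<le> m"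
    and t: "t < m" and b: "b \<in> carrier_vec m"
    and UV: "\<And>i j. i < r \<Longrightarrow> j < m \<Longrightarrow> coords U i j = coords V i j"
  shows "(truncated_pinv B r U s V *\<^sub>v b) $ t =
    (\<Sum>i<r. inverse (s (Suc i)) * dot m (coords V i) (\<lambda>j. b $ j) * coords V i t)"
proof -
  let ?T = "truncated_pinv B r U s V"
  have T: "?T \<in> carrier_mat m m" using V B by (auto simp: truncated_pinv_def rect_diag_def)
  have "?T $$ (t, j) = (\<Sum>i<r. coords V i t * inverse (s (Suc i)) * coords V i j)" if "j < m" for j
  proof -
    have "?T $$ (t, j) = (\<Sum>i<r. V $$ (t, i) * inverse (s (Suc i)) * U $$ (j, i))"
      using B mult_rect_diag_mult[OF V(2,1) r t that] by (simp add: truncated_pinv_def)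
    also have "\<dots> = (\<Sum>i<r. coords V i t * inverse (s (Suc i)) * coords V i j)"
      using UV[OF _ that] by (intro sum.cong) (auto simp: coords_def)
    finally show ?thesis .
  qed
  then have "(?T *\<^sub>v b) $ t = (\<Sum>j<m. (\<Sum>i<r. coords V i t * inverse (s (Suc i)) * coords V i j) * b $ j)"
    using T b t by (simp add: scalar_prod_def atLeast0LessThan)
  also have "\<dots> = (\<Sum>i<r. \<Sum>j<m. inverse (s (Suc i)) * (coords V i j * b $ j) * coords V i t)"
    unfolding sum_distrib_right by (subst sum.swap) (simp add: mult_ac)
  also have "\<dots> = (\<Sum>i<r. inverse (s (Suc i)) * dot m (coords V i) (\<lambda>j. b $ j) * coords V i t)"
    by (simp add: dot_def sum_distrib_left sum_distrib_right mult.assoc)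
  finally show ?thesis .
qed

text \<open>Orthonormality picks out one summand. The families \<open>u\<close> and \<open>v\<close>
  are kept apart to cover left and right singular vectors before they are known to coincide.\<close>

lemma matvec_outer_sum:
  fixes p m :: nat
  assumes G: "\<And>i j. i < m \<Longrightarrow> j < m \<Longrightarrow> G i j = (\<Sum>k<p. u k i * a k * v k j)"
    and orth: "\<And>i j. i < m \<Longrightarrow> j < m \<Longrightarrow> dot m (v i) (v j) = (if i = j then 1 else 0)"
    and p: "p \<le> m" and it: "i < m" "t < m"
  shows "matvec m G (v i) t = (if i < p then a i * u i t else 0)"
proof -
  have "matvec m G (v i) t = (\<Sum>j<m. \<Sum>k<p. u k t * a k * v k j * v i j)"
    unfolding matvec_def using it G by (intro sum.cong) (auto simp: sum_distrib_right)
  also have "\<dots> = (\<Sum>k<p. u k t * a k * dot m (v k) (v i))"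
    by (subst sum.swap) (simp add: dot_def sum_distrib_left mult.assoc)
  also have "\<dots> = (\<Sum>k<p. if k = i then a i * u i t else 0)"
    using orth it p by (intro sum.cong) auto
  also have "\<dots> = (if i < p then a i * u i t else 0)" by simp
  finally show ?thesis .
qed

text \<open>The matrix has the same column space as the one with columns \<open>v k\<close>,
  \<open>k < p\<close>, and these are independent by orthonormality.\<close>

lemma rank_eq_card_eigenvectors:
  assumes G: "\<And>i j. i < m \<Longrightarrow> j < m \<Longrightarrow> G i j = (\<Sum>k<p. v k i * a k * v k j)"
    and orth: "\<And>i j. i < m \<Longrightarrow> j < m \<Longrightarrow> dot m (v i) (v j) = (if i = j then 1 else 0)"
    and p: "p \<le> m" and a: "\<And>k. k < p \<Longrightarrow> a k \<noteq> 0"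
  shows "vec_space.rank m (Matrix.mat m m (\<lambda>(i, j). G i j)) = p"
proof -
  interpret vec_space "TYPE(real)" m .
  let ?B = "Matrix.mat m m (\<lambda>(i, j). G i j)" and ?V = "Matrix.mat m p (\<lambda>(t, k). v k t)"
  have B: "?B \<in> carrier_mat m m" and V: "?V \<in> carrier_mat m p" by auto
  have Bmul: "?B *\<^sub>v x = ?V *\<^sub>v Matrix.vec p (\<lambda>k. a k * dot m (v k) (\<lambda>j. x $ j))"
    if "x \<in> carrier_vec m" for x
  proof (rule eq_vecI)
    fix i assume "i < dim_vec (?V *\<^sub>v Matrix.vec p (\<lambda>k. a k * dot m (v k) (\<lambda>j. x $ j)))"
    then have i: "i < m" by simp
    have "(?B *\<^sub>v x) $ i = (\<Sum>j<m. \<Sum>k<p. v k i * a k * v k j * x $ j)"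
      using that i G by (simp add: scalar_prod_def atLeast0LessThan sum_distrib_right)
    also have "\<dots> = (\<Sum>k<p. v k i * (a k * dot m (v k) (\<lambda>j. x $ j)))"
      by (subst sum.swap) (simp add: dot_def sum_distrib_left mult.assoc)
    finally show "(?B *\<^sub>v x) $ i = (?V *\<^sub>v Matrix.vec p (\<lambda>k. a k * dot m (v k) (\<lambda>j. x $ j))) $ i"
      using i by (simp add: scalar_prod_def atLeast0LessThan)
  qed simp
  \<comment> \<open>Dividing the coefficients by the nonzero \<open>a k\<close> gives a preimage
    under \<open>?B\<close>.\<close>
  have Vmul: "?V *\<^sub>v c = ?B *\<^sub>v Matrix.vec m (\<lambda>t. \<Sum>k<p. (c $ k / a k) * v k t)"
    if c: "c \<in> carrier_vec p" for c
  proof -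
    have "a k * dot m (v k) (\<lambda>j. Matrix.vec m (\<lambda>t. \<Sum>k<p. (c $ k / a k) * v k t) $ j) = c $ k"
      if k: "k < p" for k
    proof -
      have "dot m (v k) (\<lambda>j. Matrix.vec m (\<lambda>t. \<Sum>k<p. (c $ k / a k) * v k t) $ j) =
          dot m (v k) (\<lambda>t. \<Sum>k<p. (c $ k / a k) * v k t)"
        by (rule dot_cong) simp_all
      also have "\<dots> = c $ k / a k"
        unfolding dot_commute[of m "v k"] using orth p k by (intro dot_orthonormal_sum) auto
      finally show ?thesis using a[OF k] by simp
    qed
    then have "Matrix.vec p (\<lambda>k. a k * dot m (v k) (\<lambda>j. Matrix.vec m (\<lambda>t. \<Sum>k<p. (c $ k / a k) * v k t) $ j)) = c"
      using c by (intro eq_vecI) auto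
    then show ?thesis by (subst Bmul) auto
  qed
  have "span (set (cols ?B)) = span (set (cols ?V))"
  proof -
    have "col_space ?B = col_space ?V"
      unfolding col_space_eq[OF B] col_space_eq[OF V]
    proof (intro subset_antisym subsetI)
      fix y assume "y \<in> {y \<in> carrier_vec (dim_row ?B). \<exists>x\<in>carrier_vec (dim_col ?B). ?B *\<^sub>v x = y}"
      then obtain x where x: "y \<in> carrier_vec m" "x \<in> carrier_vec m" "?B *\<^sub>v x = y" by auto
      show "y \<in> {y \<in> carrier_vec (dim_row ?V). \<exists>x\<in>carrier_vec (dim_col ?V). ?V *\<^sub>v x = y}"
        using x(1) Bmul[OF x(2)] x(3)
        by (intro CollectI conjI bexI[of _ "Matrix.vec p (\<lambda>k. a k * dot m (v k) (\<lambda>j. x $ j))"]) auto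
    next
      fix y assume "y \<in> {y \<in> carrier_vec (dim_row ?V). \<exists>x\<in>carrier_vec (dim_col ?V). ?V *\<^sub>v x = y}"
      then obtain c where c: "y \<in> carrier_vec m" "c \<in> carrier_vec p" "?V *\<^sub>v c = y" by auto
      show "y \<in> {y \<in> carrier_vec (dim_row ?B). \<exists>x\<in>carrier_vec (dim_col ?B). ?B *\<^sub>v x = y}"
        using c(1) Vmul[OF c(2)] c(3)
        by (intro CollectI conjI bexI[of _ "Matrix.vec m (\<lambda>t. \<Sum>k<p. (c $ k / a k) * v k t)"]) auto
    qed
    then show ?thesis by (simp only: col_space_def)
  qed
  then have "rank ?B = rank ?V" by (simp only: rank_def)
  also have "rank ?V = p"
  proof (rule lin_indpt_full_rank[OF V])
    show dist: "distinct (cols ?V)"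
      unfolding distinct_conv_nth
    proof (intro allI impI notI)
      fix i j assume ij: "i < length (cols ?V)" "j < length (cols ?V)" "i \<noteq> j" "cols ?V ! i = cols ?V ! j"
      then have "Matrix.vec m (v i) = Matrix.vec m (v j)" by simp
      then have "v i t = v j t" if "t < m" for t using that by (metis index_vec)
      then have "dot m (v i) (v i) = dot m (v i) (v j)" by (intro dot_cong) auto
      then show False using orth[of i i] orth[of i j] ij p by simp
    qed
    show "lin_indpt (set (cols ?V))"
    proof
      assume "lin_dep (set (cols ?V))"
      then obtain c where c: "c \<in> carrier_vec p" "c \<noteq> 0\<^sub>v p" "?V *\<^sub>v c = 0\<^sub>v m"
        using lin_depE[OF V _ dist] by blast
      have "c $ k = 0" if k: "k < p" for k
      proof -
        have "c $ k = dot m (\<lambda>t. \<Sum>k<p. c $ k * v k t) (v k)"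
          using orth p k by (intro dot_orthonormal_sum[symmetric]) auto
        also have "\<dots> = dot m (\<lambda>t. (?V *\<^sub>v c) $ t) (v k)"
          using c(1) by (intro dot_cong) (simp_all add: scalar_prod_def atLeast0LessThan mult.commute)
        also have "\<dots> = 0" by (simp add: c(3) dot_def)
        finally show ?thesis .
      qed
      then show False using c(1,2) by (metis carrier_vecD eq_vecI index_zero_vec(1,2))
    qed
  qed
  finally show ?thesis .
qed

section \<open>Translation between decompositions of \<open>gram_mat\<close> and eigenbases\<close>

context l2_frame
begin

definition gram_mat :: "real Matrix.mat" where
  "gram_mat = Matrix.mat m m (\<lambda>(i, j). gram i j)"

lemma gram_mat_carrier: "gram_mat \<in> carrier_mat m m"
  by (simp add: gram_mat_def)

text \<open>By symmetry the decomposition can be read both ways: for \<open>i < p\<close>,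
  \<open>gram\<close> maps each right singular vector to \<open>s (Suc i)\<close> times the left one
  and conversely. Nonnegativity forces the two to coincide.\<close>

lemma eigenbasis_of_svd:
  assumes svd: "is_svd gram_mat U s V"
  defines "p \<equiv> vec_space.rank m gram_mat"
  shows "eigenbasis (coords V) s p"
    and "\<And>i t. i < p \<Longrightarrow> t < m \<Longrightarrow> coords U i t = coords V i t"
proof -
  have orthU: "orthogonal_square m U" and orthV: "orthogonal_square m V"
    and pos: "\<And>i. i \<in> {1..p} \<Longrightarrow> 0 < s i"
    and eq: "gram_mat = U * rect_diag m m p s * transpose_mat V"
    using svd gram_mat_carrier unfolding is_svd_def Let_def p_def by auto
  have carr: "U \<in> carrier_mat m m" "V \<in> carrier_mat m m"
    using orthU orthV by (simp_all add: orthogonal_square_def)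
  have pm: "p \<le> m" unfolding p_def by (rule vec_space.rank_le_nc[OF gram_mat_carrier])
  let ?u = "coords U" and ?v = "coords V"
  have G: "gram i j = (\<Sum>k<p. ?u k i * s (Suc k) * ?v k j)" if "i < m" "j < m" for i j
  proof -
    have "gram i j = gram_mat $$ (i, j)" using that by (simp add: gram_mat_def)
    then show ?thesis
      unfolding eq mult_rect_diag_mult[OF carr pm that] by (simp add: coords_def)
  qed
  have G': "gram i j = (\<Sum>k<p. ?v k i * s (Suc k) * ?u k j)" if "i < m" "j < m" for i j
    using G[OF that(2,1)] by (simp add: gram_sym[of i j] mult_ac)
  have Gv: "matvec m gram (?v i) t = (if i < p then s (Suc i) * ?u i t else 0)" if "i < m" "t < m" for i t
    using G orthogonal_square_coords[OF orthV] pm that by (rule matvec_outer_sum)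
  have Gu: "matvec m gram (?u i) t = (if i < p then s (Suc i) * ?v i t else 0)" if "i < m" "t < m" for i t
    using G' orthogonal_square_coords[OF orthU] pm that by (rule matvec_outer_sum)
  \<comment> \<open>\<open>v i - u i\<close> would be an eigenvector for the negative eigenvalue \<open>- s (Suc i)\<close>.\<close>
  show uv: "?u i t = ?v i t" if i: "i < p" and t: "t < m" for i t
  proof -
    let ?z = "\<lambda>t. ?v i t - ?u i t"
    have "dot m ?z (matvec m gram ?z) = dot m ?z (\<lambda>t. (- s (Suc i)) * ?z t)"
      using i pm by (intro dot_cong) (simp_all add: matvec_linear Gv Gu algebra_simps)
    also have "\<dots> = - s (Suc i) * dot m ?z ?z" by (rule dot_linear)
    finally have "s (Suc i) * dot m ?z ?z \<le> 0" using dot_gram_nonneg[of ?z] by simp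
    moreover have "0 < s (Suc i)" using pos[of "Suc i"] i by simp
    ultimately have "dot m ?z ?z = 0" using dot_self_nonneg[of m ?z] by (simp add: mult_le_0_iff)
    then show ?thesis unfolding dot_self_eq_0 using t by simp
  qed
  show "eigenbasis ?v s p"
    unfolding eigenbasis_def
  proof (intro conjI ballI allI impI)
    fix i t assume "i < m" "t < m"
    then show "matvec m gram (?v i) t = (if i < p then s (Suc i) else 0) * ?v i t"
      using Gv[of i t] uv[of i t] by simp
  qed (use pm pos orthogonal_square_coords[OF orthV] in auto)
qed

text \<open>From matrix to operator: the decomposition behind \<open>w\<close> becomes an
  eigenbasis, and \<open>synthesis\<close> of \<open>w\<close> takes the form found in
  \<open>projected_solution_eq\<close>.\<close>

lemma tsvd_solution_gram_mat:
  assumes tsvd: "tsvd_solution gram_mat b r w" and b: "b \<in> carrier_vec m"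
  obtains v s p where "eigenbasis v s p" "\<forall>i\<in>{1..p}. \<forall>j\<in>{1..p}. i \<le> j \<longrightarrow> s j \<le> s i"
    "r \<le> p" "synthesis (\<lambda>t. w $ t) =
      synthesis (\<lambda>t. \<Sum>i<r. inverse (s (Suc i)) * dot m (v i) (\<lambda>j. b $ j) * v i t)"
proof -
  define p where "p = vec_space.rank m gram_mat"
  have dim: "dim_row gram_mat = m" "dim_col gram_mat = m" by (simp_all add: gram_mat_def)
  obtain U s V where r: "r \<le> p" and svd: "is_svd gram_mat U s V"
    and w: "w = truncated_pinv gram_mat r U s V *\<^sub>v b"
    using tsvd unfolding tsvd_solution_def p_def dim by blast
  have carr: "U \<in> carrier_mat m m" "V \<in> carrier_mat m m"
    and dec: "\<forall>i\<in>{1..p}. \<forall>j\<in>{1..p}. i \<le> j \<longrightarrow> s j \<le> s i"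
    using svd unfolding is_svd_def Let_def dim p_def orthogonal_square_def by auto
  note eig = eigenbasis_of_svd[OF svd, folded p_def]
  have "r \<le> m" using eig(1) r by (simp add: eigenbasis_def)
  have UV: "coords U i t = coords V i t" if "i < r" "t < m" for i t
    using eig(2) that r by simp
  have "synthesis (\<lambda>t. w $ t) =
      synthesis (\<lambda>t. \<Sum>i<r. inverse (s (Suc i)) * dot m (coords V i) (\<lambda>j. b $ j) * coords V i t)"
    unfolding w by (rule synthesis_cong)
      (rule truncated_pinv_nth[OF carr gram_mat_carrier \<open>r \<le> m\<close> _ b UV])
  then show ?thesis using that eig(1) dec r by blast
qed

text \<open>From operator to matrix: a sorted eigenbasis yields a decomposition with the same
  orthogonal matrix on both sides.\<close>

lemma tsvd_solution_of_eigenbasis: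
  assumes basis: "eigenbasis v s p"
    and dec: "\<forall>i\<in>{1..p}. \<forall>j\<in>{1..p}. i \<le> j \<longrightarrow> s j \<le> s i"
    and r: "1 \<le> r" "r \<le> p" and b: "b \<in> carrier_vec m"
  obtains w where "tsvd_solution gram_mat b r w" "synthesis (\<lambda>t. w $ t) =
      synthesis (\<lambda>t. \<Sum>i<r. inverse (s (Suc i)) * dot m (v i) (\<lambda>j. b $ j) * v i t)"
proof -
  interpret l2_frame_eigenbasis L m g v s p using basis by unfold_locales
  define V where "V = Matrix.mat m m (\<lambda>(t, i). v i t)"
  have V: "V \<in> carrier_mat m m" by (simp add: V_def)
  have coords: "coords V i t = v i t" if "i < m" "t < m" for i t
    using that by (simp add: coords_def V_def)
  have VV: "transpose_mat V * V = 1\<^sub>m m"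
    using v_orth by (intro eq_matI) (auto simp: V_def scalar_prod_def dot_def atLeast0LessThan)
  then have orth: "orthogonal_square m V"
    using V mat_mult_left_right_inverse[OF _ V VV] by (simp add: orthogonal_square_def)
  have G: "gram i j = (\<Sum>k<p. v k i * s (Suc k) * v k j)" if "i < m" "j < m" for i j
  proof -
    \<comment> \<open>Row \<open>i\<close> is expanded in the basis; its coefficient along
      \<open>v k\<close> is entry \<open>i\<close> of \<open>gram\<close> applied to
      \<open>v k\<close>.\<close>
    have "gram i j = (\<Sum>k<m. dot m (gram i) (v k) * v k j)"
      using v_orth that(2) by (rule orthonormal_expansion)
    also have "\<dots> = (\<Sum>k<m. matvec m gram (v k) i * v k j)"
      by (simp add: dot_def matvec_def)
    also have "\<dots> = (\<Sum>k<m. if k < p then v k i * s (Suc k) * v k j else 0)"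
      using that by (intro sum.cong) (auto simp: v_eigen)
    also have "\<dots> = (\<Sum>k<p. v k i * s (Suc k) * v k j)"
      using p_le by (intro sum.mono_neutral_cong_right) auto
    finally show ?thesis .
  qed
  have s_nz: "s (Suc k) \<noteq> 0" if "k < p" for k using s_pos[OF that] by simp
  \<comment> \<open>\<open>is_svd\<close> takes the number of singular values from the rank, so the
    rank must be identified with \<open>p\<close>.\<close>
  have rank: "vec_space.rank m gram_mat = p"
    unfolding gram_mat_def using G v_orth p_le s_nz by (rule rank_eq_card_eigenvectors)
  have eq: "gram_mat = V * rect_diag m m p s * transpose_mat V"
  proof (rule eq_matI)
    fix i j assume "i < dim_row (V * rect_diag m m p s * transpose_mat V)"
      "j < dim_col (V * rect_diag m m p s * transpose_mat V)"
    then have ij: "i < m" "j < m" using V by simp_all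
    then show "gram_mat $$ (i, j) = (V * rect_diag m m p s * transpose_mat V) $$ (i, j)"
      unfolding mult_rect_diag_mult[OF V V p_le ij] using p_le
      by (simp add: gram_mat_def G V_def)
  qed (use V in \<open>simp_all add: gram_mat_def\<close>)
  have dim: "dim_row gram_mat = m" "dim_col gram_mat = m" by (simp_all add: gram_mat_def)
  have "is_svd gram_mat V s V"
    unfolding is_svd_def Let_def dim rank using orth s_pos' dec eq by blast
  then have "tsvd_solution gram_mat b r (truncated_pinv gram_mat r V s V *\<^sub>v b)"
    unfolding tsvd_solution_def dim rank using r by blast
  moreover have "synthesis (\<lambda>t. (truncated_pinv gram_mat r V s V *\<^sub>v b) $ t) =
      synthesis (\<lambda>t. \<Sum>i<r. inverse (s (Suc i)) * dot m (v i) (\<lambda>j. b $ j) * v i t)"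
  proof (rule synthesis_cong)
    fix t assume t: "t < m"
    have rm: "r \<le> m" using r p_le by simp
    have "dot m (coords V i) (\<lambda>j. b $ j) = dot m (v i) (\<lambda>j. b $ j)" if "i < r" for i
      using that rm by (intro dot_cong) (simp_all add: coords)
    then show "(truncated_pinv gram_mat r V s V *\<^sub>v b) $ t =
        (\<Sum>i<r. inverse (s (Suc i)) * dot m (v i) (\<lambda>j. b $ j) * v i t)"
      unfolding truncated_pinv_nth[OF V V gram_mat_carrier rm t b refl]
      using rm t by (intro sum.cong) (auto simp: coords)
  qed
  ultimately show ?thesis by (rule that)
qed

end

section \<open>The truncated solutions agree\<close>

text \<open>\<open>hausdorff_measure\<close> carries the Borel sigma-algebra by construction, so
  \<Gamma> is measurable; its indicator then passes square integrability to the restriction.\<close>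

lemma boundary_density_L2:
  assumes "\<Gamma> \<in> sets borel" "\<Gamma> \<subseteq> frontier D" "\<rho> \<in> L2 (boundary_measure D)"
  shows "(\<rho> :: real^'n \<Rightarrow> real) \<in> L2 (restrict_space (boundary_measure D) \<Gamma>)"
proof -
  let ?\<sigma> = "boundary_measure D"
  have \<Gamma>: "\<Gamma> \<in> sets ?\<sigma>"
    using assms(1,2) by (auto simp: boundary_measure_def sets_restrict_space hausdorff_measure_def)
  then have "\<Gamma> \<inter> space ?\<sigma> \<in> sets ?\<sigma>" by (intro sets.Int sets.top)
  moreover have "\<rho> \<in> borel_measurable ?\<sigma>" "integrable ?\<sigma> (\<lambda>x. (\<rho> x)\<^sup>2)"
    using assms(3) by (simp_all add: L2_real_iff)
  ultimately show ?thesis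
    using integrable_mult_indicator[OF \<Gamma>, of "\<lambda>x. (\<rho> x)\<^sup>2"]
    by (simp add: L2_real_iff measurable_restrict_space1 integrable_restrict_space)
qed

text \<open>The first two claims turn a decomposition of \<open>gram_mat\<close> into
  eigenfunctions; the third builds a decomposition from eigenfunctions. If \<open>r\<close> cuts a
  multiple eigenvalue, the choices on both sides must match, so each of the last two claims lets one
  side determine the other.\<close>

lemma (in l2_frame) tsvd_solutions_agree:
  assumes lam: "nonzero_eigenvalues L frame_op k lam" and r: "1 \<le> r" "r \<le> k"
    and b: "b \<in> carrier_vec m"
  shows
    "((r = k \<or> lam (Suc r) < lam r) \<longrightarrow>
        (\<forall>ur w. projected_solution L frame_op (synthesis (\<lambda>i. b $ i)) (leading_eigenspan L frame_op lam r) ur \<and>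
           tsvd_solution gram_mat b r w \<longrightarrow>
           (AE x in L. ur x = synthesis (\<lambda>j. w $ j) x))) \<and>
     (\<forall>w. tsvd_solution gram_mat b r w \<longrightarrow>
        (\<exists>e. leading_eigensystem L frame_op lam r e \<and>
           (\<forall>ur. projected_solution L frame_op (synthesis (\<lambda>i. b $ i)) (L2_span L (e ` {1..r})) ur \<longrightarrow>
              (AE x in L. ur x = synthesis (\<lambda>j. w $ j) x)))) \<and>
     (\<forall>e. leading_eigensystem L frame_op lam r e \<longrightarrow>
        (\<exists>w. tsvd_solution gram_mat b r w \<and>
           (\<forall>ur. projected_solution L frame_op (synthesis (\<lambda>i. b $ i)) (L2_span L (e ` {1..r})) ur \<longrightarrow>
              (AE x in L. ur x = synthesis (\<lambda>j. w $ j) x))))"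
proof (intro conjI allI impI, elim conjE)
  fix ur w
  assume gap: "r = k \<or> lam (Suc r) < lam r"
    and ur: "projected_solution L frame_op (synthesis (\<lambda>i. b $ i)) (leading_eigenspan L frame_op lam r) ur"
    and w: "tsvd_solution gram_mat b r w"
  obtain v s p where vs: "eigenbasis v s p" "\<forall>i\<in>{1..p}. \<forall>j\<in>{1..p}. i \<le> j \<longrightarrow> s j \<le> s i"
    "r \<le> p" "synthesis (\<lambda>t. w $ t) =
      synthesis (\<lambda>t. \<Sum>i<r. inverse (s (Suc i)) * dot m (v i) (\<lambda>j. b $ j) * v i t)"
    using w b by (rule tsvd_solution_gram_mat) (rule that)
  interpret l2_frame_eigenbasis L m g v s p using vs(1) by unfold_locales
  have dec: "s j \<le> s i" if "0 < i" "i \<le> j" "j \<le> p" for i j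
    by (rule vs(2)[rule_format]) (use that in auto)
  \<comment> \<open>The singular values are sorted throughout, so the prescribed part is
    empty.\<close>
  have eq: "k = p" "\<And>i. i \<in> {1..p} \<Longrightarrow> lam i = s i"
    by (rule nonzero_eigenvalues_eq[OF lam, of 0]; use dec in simp)+
  have "s j \<noteq> s i" if ij: "i \<in> {1..r}" "r < j" "j \<le> p" for i j
  proof -
    have "s j \<le> s (Suc r)" "s r \<le> s i" using ij r by (intro dec; simp)+
    \<comment> \<open>Here \<open>r < j\<close>, \<open>j \<le> p\<close> and \<open>p = k\<close>
      rule out \<open>r = k\<close>, so the strict gap is available.\<close>
    moreover have "s (Suc r) < s r" using gap ij eq r by auto
    ultimately show ?thesis by simp
  qed
  then show "AE x in L. ur x = synthesis (\<lambda>j. w $ j) x"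
    unfolding vs(4) using vs(3) eq ur by (intro projected_solution_eigenspan) auto
next
  fix w
  assume w: "tsvd_solution gram_mat b r w"
  obtain v s p where vs: "eigenbasis v s p" "\<forall>i\<in>{1..p}. \<forall>j\<in>{1..p}. i \<le> j \<longrightarrow> s j \<le> s i"
    "r \<le> p" "synthesis (\<lambda>t. w $ t) =
      synthesis (\<lambda>t. \<Sum>i<r. inverse (s (Suc i)) * dot m (v i) (\<lambda>j. b $ j) * v i t)"
    using w b by (rule tsvd_solution_gram_mat) (rule that)
  interpret l2_frame_eigenbasis L m g v s p using vs(1) by unfold_locales
  have dec: "s j \<le> s i" if "0 < i" "i \<le> j" "j \<le> p" for i j
    by (rule vs(2)[rule_format]) (use that in auto)
  have eq: "\<And>i. i \<in> {1..p} \<Longrightarrow> lam i = s i"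
    by (rule nonzero_eigenvalues_eq[OF lam, of 0]; use dec in simp)+
  \<comment> \<open>The matching eigenfunctions are those built from the singular vectors of the
    given decomposition.\<close>
  show "\<exists>e. leading_eigensystem L frame_op lam r e \<and>
      (\<forall>ur. projected_solution L frame_op (synthesis (\<lambda>i. b $ i)) (L2_span L (e ` {1..r})) ur \<longrightarrow>
        (AE x in L. ur x = synthesis (\<lambda>j. w $ j) x))"
  proof (intro exI[of _ "\<lambda>i. efun (i - 1)"] conjI allI impI)
    show "leading_eigensystem L frame_op lam r (\<lambda>i. efun (i - 1))"
      using vs(3) eq by (rule leading_eigensystem_efun)
    fix ur assume "projected_solution L frame_op (synthesis (\<lambda>i. b $ i)) (L2_span L ((\<lambda>i. efun (i - 1)) ` {1..r})) ur"
    then show "AE x in L. ur x = synthesis (\<lambda>j. w $ j) x"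
      unfolding vs(4) by (intro projected_solution_eigensystem[OF vs(3)]) (auto simp: efun_L2)
  qed
next
  fix e
  assume e: "leading_eigensystem L frame_op lam r e"
  \<comment> \<open>The decomposition must reproduce the given eigenfunctions, so the eigenbasis is
    chosen to extend their images.\<close>
  obtain v s where vs: "eigenbasis v s k" "\<And>i. i \<in> {1..k} \<Longrightarrow> s i = lam i"
    "\<And>i. i < r \<Longrightarrow> AE x in L. e (Suc i) x = l2_frame_eigenbasis.efun m g v s i x"
    using exists_eigenbasis_extending[OF lam r(2) e] by metis
  interpret l2_frame_eigenbasis L m g v s k using vs(1) by unfold_locales
  have dec: "\<forall>i\<in>{1..k}. \<forall>j\<in>{1..k}. i \<le> j \<longrightarrow> s j \<le> s i"
    using lam vs(2) unfolding nonzero_eigenvalues_def by simp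
  obtain w where w: "tsvd_solution gram_mat b r w" "synthesis (\<lambda>t. w $ t) =
      synthesis (\<lambda>t. \<Sum>i<r. inverse (s (Suc i)) * dot m (v i) (\<lambda>j. b $ j) * v i t)"
    using vs(1) dec r b by (rule tsvd_solution_of_eigenbasis) (rule that)
  have eL: "e (Suc i) \<in> L2 L" if "i < r" for i
    using e that by (auto simp: leading_eigensystem_def L2_eigenspace_def)
  show "\<exists>w. tsvd_solution gram_mat b r w \<and>
      (\<forall>ur. projected_solution L frame_op (synthesis (\<lambda>i. b $ i)) (L2_span L (e ` {1..r})) ur \<longrightarrow>
        (AE x in L. ur x = synthesis (\<lambda>j. w $ j) x))"
  proof (intro exI[of _ w] conjI allI impI)
    fix ur assume "projected_solution L frame_op (synthesis (\<lambda>i. b $ i)) (L2_span L (e ` {1..r})) ur"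
    with r(2) eL vs(3) show "AE x in L. ur x = synthesis (\<lambda>j. w $ j) x"
      unfolding w(2) by (rule projected_solution_eigensystem)
  qed (rule w(1))
qed

theorem proposition3p2:
  fixes D :: "(real^'n) set" and K :: "real^'n \<Rightarrow> real^'n^'n"
    and \<Gamma>1 :: "(real^'n) set" and \<sigma> L :: "(real^'n) measure"
    and \<mu> :: "real^'n \<Rightarrow> (real^'n) measure" and \<rho> :: "real^'n \<Rightarrow> real^'n \<Rightarrow> real"
    and M k r :: nat and xD :: "nat \<Rightarrow> real^'n" and \<nu> :: "nat \<Rightarrow> real"
    and b b\<nu> :: "real Matrix.vec" and \<Lambda> :: "real Matrix.mat"
    and A :: "(real^'n \<Rightarrow> real) \<Rightarrow> real^'n \<Rightarrow> real" and q :: "real^'n \<Rightarrow> real"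
    and lam :: "nat \<Rightarrow> real"
  assumes dim: "2 \<le> CARD('n)"
    and domain: "open D" "connected D" "D \<noteq> {}" "bounded D"
    and K: "bounded (K ` D)" "K \<in> borel_measurable (lebesgue_on D)"
      "\<forall>x\<in>D. transpose (K x) = K x" "strictly_elliptic D K"
    and \<Gamma>1: "\<Gamma>1 \<noteq> {}" "\<Gamma>1 \<in> sets borel" "\<Gamma>1 \<subseteq> frontier D"
    and \<sigma>: "\<sigma> = boundary_measure D"
    and \<mu>: "\<forall>x\<in>D. elliptic_measure D K x (\<mu> x)"
    and \<rho>: "\<forall>x\<in>D. real_density \<sigma> (\<mu> x) (\<rho> x) \<and> \<rho> x \<in> L2 \<sigma>"
    and M: "1 \<le> M" "\<forall>i<M. xD i \<in> D"
    and \<nu>: "\<forall>i<M. 0 < \<nu> i \<and> \<nu> i < 1" "(\<Sum>i<M. (\<nu> i)\<^sup>2) = 1"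
    and L: "L = restrict_space \<sigma> \<Gamma>1"
    and b: "b \<in> carrier_vec M" "b\<nu> = mat_diag M \<nu> *\<^sub>v b"
    and A: "A = (\<lambda>u. T_adj M \<nu> (\<lambda>i. \<rho> (xD i)) (T_op L M \<nu> (\<lambda>i. \<rho> (xD i)) u))"
    and q: "q = T_adj M \<nu> (\<lambda>i. \<rho> (xD i)) b\<nu>"
    and \<Lambda>: "\<Lambda> = Lambda_mat L M \<nu> (\<lambda>i. \<rho> (xD i))"
    and k: "k = L2_dim L (L2_orth L (L2_kernel L A))"
    and lam: "nonzero_eigenvalues L A k lam"
    and r: "1 \<le> r" "r \<le> k"
  shows
    \<comment> \<open>If \<open>r\<close> does not cut through a multiple eigenvalue, both TSVD solutions are uniquely determined.\<close>
    "((r = k \<or> lam (Suc r) < lam r) \<longrightarrow>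
        (\<forall>ur w. projected_solution L A q (leading_eigenspan L A lam r) ur \<and> tsvd_solution \<Lambda> b\<nu> r w \<longrightarrow>
           (AE x in L. ur x = (\<Sum>j<M. \<nu> j * w $ j * \<rho> (xD j) x)))) \<and>
     \<comment> \<open>For every \<open>r\<close>, with the choices of eigenfunctions and of the matrix SVD matching each other.\<close>
     (\<forall>w. tsvd_solution \<Lambda> b\<nu> r w \<longrightarrow>
        (\<exists>e. leading_eigensystem L A lam r e \<and>
           (\<forall>ur. projected_solution L A q (L2_span L (e ` {1..r})) ur \<longrightarrow>
              (AE x in L. ur x = (\<Sum>j<M. \<nu> j * w $ j * \<rho> (xD j) x))))) \<and>
     (\<forall>e. leading_eigensystem L A lam r e \<longrightarrow>
        (\<exists>w. tsvd_solution \<Lambda> b\<nu> r w \<and>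
           (\<forall>ur. projected_solution L A q (L2_span L (e ` {1..r})) ur \<longrightarrow>
              (AE x in L. ur x = (\<Sum>j<M. \<nu> j * w $ j * \<rho> (xD j) x)))))"
proof -
  \<comment> \<open>Absorbing the weights into the family identifies \<open>A\<close>,
    \<open>q\<close> and \<Lambda> with \<open>frame_op\<close>, \<open>synthesis\<close> of
    \<open>b\<nu>\<close> and \<open>gram_mat\<close>.\<close>
  define g where "g = (\<lambda>i x. \<nu> i * \<rho> (xD i) x)"
  have "g i \<in> L2 L" if "i < M" for i
    unfolding g_def L \<sigma> using that M(2) \<rho> \<Gamma>1 \<sigma>
    by (intro L2_cmult boundary_density_L2) auto
  then interpret l2_frame L M g by unfold_locales
  have ana: "analysis u i = \<nu> i * (LINT x|L. u x * \<rho> (xD i) x)" for u i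
    unfolding analysis_def ip_def by (simp add: g_def mult.left_commute)
  have synth: "synthesis a x = (\<Sum>j<M. \<nu> j * a j * \<rho> (xD j) x)" for a x
    unfolding synthesis_def by (simp add: g_def mult_ac)
  have A': "A = frame_op"
    unfolding A frame_op_def
    by (intro ext) (simp add: T_adj_def T_op_def synth ana)
  have q': "q = synthesis (\<lambda>i. b\<nu> $ i)"
    by (intro ext) (simp add: q T_adj_def synth)
  have \<Lambda>': "\<Lambda> = gram_mat"
    unfolding \<Lambda> Lambda_mat_def gram_mat_def gram_def
    by (intro eq_matI) (simp_all add: g_def ip_cmult, simp add: ip_def)
  have b': "b\<nu> \<in> carrier_vec M" 
    unfolding b(2) by (rule mult_mat_vec_carrier[OF mat_diag_dim b(1)])
  show ?thesis
    using tsvd_solutions_agree[OF lam[unfolded A'] r b']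
    unfolding A' q' \<Lambda>' synth .
qed

end
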